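(* Let $A$ be a quasinormed operator ideal and let $X$ be a Banach space for which the set of finite rank operators is dense in the space $A(X)$. Suppose that the standard functional $\operatorname{trace}$ is bounded on the subspace of all finite rank operators of $A(X)$ (and thus can be extended to a continuous trace on all of $A(X)$). Then the corresponding Fredholm determinant $u\mapsto\det(1-u)$ is uniformly continuous (with respect to the $A$-quasinorm) on some $A$-ball of the subspace of all finite rank operators of $A(X)$. Moreover, there exist constants $r_0\in(0,1)$ and $c_0>0$ such that for all finite rank $u,v\in A(X)$ with $\|u\|_A\le r_0$ and $\|v\|_A\le r_0$, $$|\det(1-u)-\det(1-v)|\le c_0\,\|u-v\|_A.$$
   Context: Banach spaces are complex. An operator ideal $A$ is a class of bounded operators with components $A(X,Y)\subset L(X,Y)$ such that the identity $1_K$ of the one-dimensional space $K$ is in $A$, each $A(X,Y)$ is a linear subspace, and $TUS\in A(Z,W)$ for $S\in L(Z,X)$, $U\in A(X,Y)$, $T\in L(Y,W)$. It is quasinormed if it carries a function $\|\cdot\|_A$ that is a quasinorm on each component (positive definite, homogeneous, with $\|U+V\|_A\le C(\|U\|_A+\|V\|_A)$ for some constant $C$), with $\|1_K\|_A=1$ and $\|TUS\|_A\le\|T\|\,\|U\|_A\,\|S\|$. Write $A(X)=A(X,X)$. For a finite rank operator $u=\sum_{k=1}^N x_k'\otimes x_k$ on $X$, $\operatorname{trace}u=\sum_{k=1}^N x_k'(x_k)$ and $\det(1-u)=\prod_j(1-\mu_j)$, where $(\mu_j)$ is the complete system of eigenvalues of $u$, counted with multiplicity. Boundedness of the trace means $|\operatorname{trace}u|\le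 b\|u\|_A$ for some constant $b$ and all finite rank $u\in A(X)$. *)

theory Defs
  imports "HOL-Analysis.Analysis"
begin

section \<open>Complex vector spaces\<close>

class complex_vector = ab_group_add +
  fixes scaleC :: "complex \<Rightarrow> 'a \<Rightarrow> 'a"  (infixr \<open>*\<^sub>C\<close> 75)
  assumes scaleC_add_right: "a *\<^sub>C (x + y) = a *\<^sub>C x + a *\<^sub>C y"
    and scaleC_add_left: "(a + b) *\<^sub>C x = a *\<^sub>C x + b *\<^sub>C x"
    and scaleC_scaleC: "a *\<^sub>C (b *\<^sub>C x) = (a * b) *\<^sub>C x"
    and scaleC_one: "1 *\<^sub>C x = x"

interpretation cvs: vector_space "scaleC :: complex \<Rightarrow> 'a \<Rightarrow> 'a::complex_vector"
  by unfold_locales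
    (simp_all add: scaleC_add_right scaleC_add_left scaleC_scaleC scaleC_one)


section \<open>Banach spaces and bounded operators\<close>

text \<open>An operator ideal lives on all Banach spaces at once, so Banach spaces must be objects rather
  than types. The type \<open>'a\<close> serves as a universe: a Banach space is a linear subspace of \<open>'a\<close>
  with a complete norm of its own, unrelated for different spaces. Since \<open>'a\<close> is an arbitrary
  complex vector space, without any topology, every set of Banach spaces is realized, up to
  isometric isomorphism, in a suitable universe (for instance in the algebraic direct sum).

  Norms and operators are extended by 0 outside the underlying subspace. Hence equal norms or
  operators are equal functions, and sums and compositions of operators are the pointwise sum
  and \<open>(\<circ>)\<close>.\<close>

record 'a nspace =
  carr :: "'a set"
  nrm :: "'a \<Rightarrow> real"

locale complex_banach =
  fixes X :: "'a::complex_vector nspace"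
  assumes subspace_carr: "cvs.subspace (carr X)"
    and nrm_outside: "x \<notin> carr X \<Longrightarrow> nrm X x = 0"
    and nrm_nonneg: "x \<in> carr X \<Longrightarrow> 0 \<le> nrm X x"
    and nrm_eq_0_iff: "x \<in> carr X \<Longrightarrow> nrm X x = 0 \<longleftrightarrow> x = 0"
    and nrm_scaleC: "x \<in> carr X \<Longrightarrow> nrm X (c *\<^sub>C x) = cmod c * nrm X x"
    and nrm_triangle: "x \<in> carr X \<Longrightarrow> y \<in> carr X \<Longrightarrow> nrm X (x + y) \<le> nrm X x + nrm X y"
    and complete: "Metric_space.mcomplete (carr X) (\<lambda>x y. nrm X (x - y))"

lemma (in complex_banach) Metric_space_nrm: "Metric_space (carr X) (\<lambda>x y. nrm X (x - y))"
proof
  have minus: "nrm X (- x) = nrm X x" for x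
  proof (cases "x \<in> carr X")
    case True
    then show ?thesis using nrm_scaleC[of x "- 1"] by (simp add: scaleC_one)
  next
    case False
    then have "- x \<notin> carr X" using cvs.subspace_neg[OF subspace_carr, of "- x"] by auto
    then show ?thesis using False by (simp add: nrm_outside)
  qed
  show "0 \<le> nrm X (x - y)" for x y
    by (cases "x - y \<in> carr X") (simp_all add: nrm_nonneg nrm_outside)
  show "nrm X (x - y) = nrm X (y - x)" for x y
    using minus[of "x - y"] by simp
  show "nrm X (x - y) = 0 \<longleftrightarrow> x = y" if "x \<in> carr X" "y \<in> carr X" for x y
    using nrm_eq_0_iff[OF cvs.subspace_diff[OF subspace_carr that]] by simp
  show "nrm X (x - z) \<le> nrm X (x - y) + nrm X (y - z)"
    if "x \<in> carr X" "y \<in> carr X" "z \<in> carr X" for x y z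
    using nrm_triangle[of "x - y" "y - z"] cvs.subspace_diff[OF subspace_carr] that by simp
qed

definition bounded_ops :: "'a::complex_vector nspace \<Rightarrow> 'a nspace \<Rightarrow> ('a \<Rightarrow> 'a) set" where
  "bounded_ops X Y = {T.
     (\<forall>x\<in>carr X. T x \<in> carr Y) \<and> (\<forall>x. x \<notin> carr X \<longrightarrow> T x = 0) \<and>
     (\<forall>x\<in>carr X. \<forall>y\<in>carr X. T (x + y) = T x + T y) \<and>
     (\<forall>c. \<forall>x\<in>carr X. T (c *\<^sub>C x) = c *\<^sub>C T x) \<and>
     (\<exists>M. \<forall>x\<in>carr X. nrm Y (T x) \<le> M * nrm X x)}"

definition op_nrm :: "'a::complex_vector nspace \<Rightarrow> 'a nspace \<Rightarrow> ('a \<Rightarrow> 'a) \<Rightarrow> real" where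
  "op_nrm X Y T = (SUP x\<in>{x \<in> carr X. nrm X x \<le> 1}. nrm Y (T x))"

definition id_op :: "'a::complex_vector nspace \<Rightarrow> 'a \<Rightarrow> 'a" where
  "id_op X = (\<lambda>x. if x \<in> carr X then x else 0)"

definition dual_space :: "'a::complex_vector nspace \<Rightarrow> ('a \<Rightarrow> complex) set" where
  "dual_space X = {f.
     (\<forall>x. x \<notin> carr X \<longrightarrow> f x = 0) \<and>
     (\<forall>x\<in>carr X. \<forall>y\<in>carr X. f (x + y) = f x + f y) \<and>
     (\<forall>c. \<forall>x\<in>carr X. f (c *\<^sub>C x) = c * f x) \<and>
     (\<exists>M. \<forall>x\<in>carr X. cmod (f x) \<le> M * nrm X x)}"


section \<open>Quasinormed operator ideals\<close>

text \<open>The scalar field \<open>K\<close>, as a Banach space, is represented by every one-dimensional Banach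
  space in the universe; these are all isometrically isomorphic.\<close>

locale operator_ideal =
  fixes A :: "'a::complex_vector nspace \<Rightarrow> 'a nspace \<Rightarrow> ('a \<Rightarrow> 'a) set"
  assumes ideal_subset:
      "complex_banach X \<Longrightarrow> complex_banach Y \<Longrightarrow> A X Y \<subseteq> bounded_ops X Y"
    and ideal_id:
      "complex_banach K \<Longrightarrow> cvs.dim (carr K) = 1 \<Longrightarrow> id_op K \<in> A K K"
    and ideal_zero:
      "complex_banach X \<Longrightarrow> complex_banach Y \<Longrightarrow> (\<lambda>x. 0) \<in> A X Y"
    and ideal_add:
      "complex_banach X \<Longrightarrow> complex_banach Y \<Longrightarrow> U \<in> A X Y \<Longrightarrow> V \<in> A X Y \<Longrightarrow>
        (\<lambda>x. U x + V x) \<in> A X Y"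
    and ideal_scaleC:
      "complex_banach X \<Longrightarrow> complex_banach Y \<Longrightarrow> U \<in> A X Y \<Longrightarrow> (\<lambda>x. c *\<^sub>C U x) \<in> A X Y"
    and ideal_comp:
      "complex_banach Z \<Longrightarrow> complex_banach X \<Longrightarrow> complex_banach Y \<Longrightarrow> complex_banach W \<Longrightarrow>
        S \<in> bounded_ops Z X \<Longrightarrow> U \<in> A X Y \<Longrightarrow> T \<in> bounded_ops Y W \<Longrightarrow>
        T \<circ> U \<circ> S \<in> A Z W"

text \<open>\<open>q X Y U\<close> is the \<open>A\<close>-quasinorm of \<open>U\<close> as an element of the component \<open>A X Y\<close>. The constant
  in the quasi-triangle inequality may depend on the component.\<close>

locale quasinormed_operator_ideal = operator_ideal A
  for A :: "'a::complex_vector nspace \<Rightarrow> 'a nspace \<Rightarrow> ('a \<Rightarrow> 'a) set" +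
  fixes q :: "'a nspace \<Rightarrow> 'a nspace \<Rightarrow> ('a \<Rightarrow> 'a) \<Rightarrow> real"
  assumes q_nonneg:
      "complex_banach X \<Longrightarrow> complex_banach Y \<Longrightarrow> U \<in> A X Y \<Longrightarrow> 0 \<le> q X Y U"
    and q_eq_0_iff:
      "complex_banach X \<Longrightarrow> complex_banach Y \<Longrightarrow> U \<in> A X Y \<Longrightarrow> q X Y U = 0 \<longleftrightarrow> U = (\<lambda>x. 0)"
    and q_scaleC:
      "complex_banach X \<Longrightarrow> complex_banach Y \<Longrightarrow> U \<in> A X Y \<Longrightarrow>
        q X Y (\<lambda>x. c *\<^sub>C U x) = cmod c * q X Y U"
    and q_quasi_triangle:
      "complex_banach X \<Longrightarrow> complex_banach Y \<Longrightarrow>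
        \<exists>C. \<forall>U\<in>A X Y. \<forall>V\<in>A X Y. q X Y (\<lambda>x. U x + V x) \<le> C * (q X Y U + q X Y V)"
    and q_id:
      "complex_banach K \<Longrightarrow> cvs.dim (carr K) = 1 \<Longrightarrow> q K K (id_op K) = 1"
    and q_comp:
      "complex_banach Z \<Longrightarrow> complex_banach X \<Longrightarrow> complex_banach Y \<Longrightarrow> complex_banach W \<Longrightarrow>
        S \<in> bounded_ops Z X \<Longrightarrow> U \<in> A X Y \<Longrightarrow> T \<in> bounded_ops Y W \<Longrightarrow>
        q Z W (T \<circ> U \<circ> S) \<le> op_nrm Y W T * q X Y U * op_nrm Z X S"


section \<open>Trace and determinant of finite rank operators\<close>

definition finite_rep ::
  "'a::complex_vector nspace \<Rightarrow> ('a \<Rightarrow> 'a) \<Rightarrow> nat \<Rightarrow> (nat \<Rightarrow> 'a \<Rightarrow> complex) \<Rightarrow> (nat \<Rightarrow> 'a) \<Rightarrow> bool"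
  where "finite_rep X u N f y \<longleftrightarrow>
    (\<forall>k<N. f k \<in> dual_space X \<and> y k \<in> carr X) \<and> u = (\<lambda>x. \<Sum>k<N. f k x *\<^sub>C y k)"

definition finite_rank_ops :: "'a::complex_vector nspace \<Rightarrow> ('a \<Rightarrow> 'a) set" where
  "finite_rank_ops X = {u \<in> bounded_ops X X. \<exists>N f y. finite_rep X u N f y}"

definition op_trace :: "'a::complex_vector nspace \<Rightarrow> ('a \<Rightarrow> 'a) \<Rightarrow> complex" where
  "op_trace X u = (THE t. \<exists>N f y. finite_rep X u N f y \<and> t = (\<Sum>k<N. f k (y k)))"

text \<open>The trace does not depend on the representation.\<close>

lemma sum_finite_rep_eq:
  assumes X: "complex_banach X" and rep: "finite_rep X u N f y"
    and B: "finite B" "cvs.independent B" "B \<subseteq> carr X" "\<And>k. k < N \<Longrightarrow> y k \<in> cvs.span B"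
  shows "(\<Sum>k<N. f k (y k)) = (\<Sum>b\<in>B. cvs.representation B (u b) b)"
proof -
  have sub: "cvs.subspace (carr X)" using X by (rule complex_banach.subspace_carr)
  have f_sum: "f k (\<Sum>b\<in>B'. c b *\<^sub>C b) = (\<Sum>b\<in>B'. c b * f k b)"
    if k: "k < N" and B': "finite B'" "B' \<subseteq> carr X" for k c B'
    using B'
  proof (induction B')
    case empty
    have "f k (0 *\<^sub>C 0) = 0 * f k 0"
      using rep k cvs.subspace_0[OF sub] unfolding finite_rep_def dual_space_def by blast
    then show ?case by simp
  next
    case (insert b B')
    have "(\<Sum>b\<in>B'. c b *\<^sub>C b) \<in> carr X"
      using insert.prems by (auto intro!: cvs.subspace_sum[OF sub] cvs.subspace_scale[OF sub])
    moreover have "b \<in> carr X" "c b *\<^sub>C b \<in> carr X"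
      using insert.prems by (auto intro!: cvs.subspace_scale[OF sub])
    moreover have "f k \<in> dual_space X" using rep k by (simp add: finite_rep_def)
    ultimately show ?case using insert by (simp add: dual_space_def)
  qed
  have "(\<Sum>k<N. f k (y k)) = (\<Sum>k<N. \<Sum>b\<in>B. cvs.representation B (y k) b * f k b)"
  proof (rule sum.cong)
    fix k assume "k \<in> {..<N}"
    then have k: "k < N" by simp
    have "y k = (\<Sum>b\<in>B. cvs.representation B (y k) b *\<^sub>C b)"
      using cvs.sum_representation_eq[OF B(2) B(4)[OF k] B(1) order_refl] by simp
    then have "f k (y k) = f k (\<Sum>b\<in>B. cvs.representation B (y k) b *\<^sub>C b)" by simp
    also have "\<dots> = (\<Sum>b\<in>B. cvs.representation B (y k) b * f k b)"
      by (rule f_sum[OF k B(1,3)])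
    finally show "f k (y k) = (\<Sum>b\<in>B. cvs.representation B (y k) b * f k b)" .
  qed simp
  also have "\<dots> = (\<Sum>b\<in>B. \<Sum>k<N. f k b * cvs.representation B (y k) b)"
    by (subst sum.swap) (simp add: mult.commute)
  also have "\<dots> = (\<Sum>b\<in>B. cvs.representation B (u b) b)"
  proof (rule sum.cong)
    fix b
    have "cvs.representation B (u b) = cvs.representation B (\<Sum>k<N. f k b *\<^sub>C y k)"
      using rep by (simp add: finite_rep_def)
    also have "\<dots> = (\<lambda>c. \<Sum>k<N. cvs.representation B (f k b *\<^sub>C y k) c)"
      using B by (intro cvs.representation_sum) (auto intro: cvs.span_scale)
    finally show "(\<Sum>k<N. f k b * cvs.representation B (y k) b) = cvs.representation B (u b) b"
      using B by (simp add: cvs.representation_scale)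
  qed simp
  finally show ?thesis .
qed

lemma op_trace_eq:
  assumes X: "complex_banach X" and rep: "finite_rep X u N f y"
  shows "op_trace X u = (\<Sum>k<N. f k (y k))"
  unfolding op_trace_def
proof (rule the_equality)
  show "\<exists>N' f' y'. finite_rep X u N' f' y' \<and> (\<Sum>k<N. f k (y k)) = (\<Sum>k<N'. f' k (y' k))"
    using rep by blast
next
  fix t assume "\<exists>N' f' y'. finite_rep X u N' f' y' \<and> t = (\<Sum>k<N'. f' k (y' k))"
  then obtain N' f' y' where rep': "finite_rep X u N' f' y'" and t: "t = (\<Sum>k<N'. f' k (y' k))"
    by blast
  let ?S = "y ` {..<N} \<union> y' ` {..<N'}"
  obtain B where B: "B \<subseteq> ?S" "cvs.independent B" "?S \<subseteq> cvs.span B"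
    using cvs.maximal_independent_subset[of ?S] by blast
  have fin: "finite B" using B(1) by (rule finite_subset) simp
  have carr: "B \<subseteq> carr X" using B(1) rep rep' by (auto simp: finite_rep_def)
  have "(\<Sum>k<N. f k (y k)) = (\<Sum>b\<in>B. cvs.representation B (u b) b)"
    using B(3) by (intro sum_finite_rep_eq[OF X rep fin B(2) carr]) auto
  moreover have "t = (\<Sum>b\<in>B. cvs.representation B (u b) b)"
    unfolding t using B(3) by (intro sum_finite_rep_eq[OF X rep' fin B(2) carr]) auto
  ultimately show "t = (\<Sum>k<N. f k (y k))" by simp
qed

definition op_eigenvalue :: "'a::complex_vector nspace \<Rightarrow> ('a \<Rightarrow> 'a) \<Rightarrow> complex \<Rightarrow> bool" where
  "op_eigenvalue X u \<mu> \<longleftrightarrow> (\<exists>x\<in>carr X. x \<noteq> 0 \<and> u x = \<mu> *\<^sub>C x)"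

text \<open>Algebraic multiplicity: the dimension of the space of generalized eigenvectors.\<close>

definition eigenvalue_mult :: "'a::complex_vector nspace \<Rightarrow> ('a \<Rightarrow> 'a) \<Rightarrow> complex \<Rightarrow> nat" where
  "eigenvalue_mult X u \<mu> =
     cvs.dim {x \<in> carr X. \<exists>n. ((\<lambda>z. u z - \<mu> *\<^sub>C z) ^^ n) x = 0}"

text \<open>\<open>fredholm_det X u\<close> is $\det(1-u)$. The eigenvalue 0, whose multiplicity may be infinite,
  only contributes factors 1 and is left out.\<close>

definition fredholm_det :: "'a::complex_vector nspace \<Rightarrow> ('a \<Rightarrow> 'a) \<Rightarrow> complex" where
  "fredholm_det X u =
     (\<Prod>\<mu> | op_eigenvalue X u \<mu> \<and> \<mu> \<noteq> 0. (1 - \<mu>) ^ eigenvalue_mult X u \<mu>)"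

end

theory Submission
  imports Defs "HOL-Computational_Algebra.Fundamental_Theorem_Algebra"
begin

text \<open>The determinant is governed by traces of powers. If \<open>u\<close> has finite rank and norm less than 1,
  then $\det(1-u) = \exp(-\sum_{n\ge 1} \mathrm{trace}(u^n)/n)$, so it suffices to compare the traces of
  \<open>u\<^sup>n\<close> and \<open>v\<^sup>n\<close>.

  The quasinorm of an operator ideal dominates the operator norm (\<open>nrm_le_quasinorm\<close>, by way of a
  norming functional from the Hahn--Banach theorem). It is therefore submultiplicative, and for
  \<open>u\<close>, \<open>v\<close> of quasinorm at most \<open>\<rho>\<close> each term of $u^n - v^n = \sum_{k<n} u^k(u-v)v^{n-1-k}$ has
  quasinorm at most $\rho^{n-1}\|u-v\|_A$. The trace is additive on finite rank operators and
  bounded by \<open>b\<close> times the quasinorm, whence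
  $|\mathrm{trace}(u^n) - \mathrm{trace}(v^n)| \le n b \rho^{n-1} \|u-v\|_A$
  (\<open>trace_funpow_diff_le\<close>); no sum of operators is estimated, so the constant of the quasi-triangle
  inequality does not enter. For \<open>\<rho> = 1/2\<close> the exponents differ by at most $2b\|u-v\|_A$ and are
  bounded by \<open>b\<close>, and \<open>exp\<close> is Lipschitz on that disc (\<open>fredholm_det_lipschitz\<close>).

  The exponential formula (\<open>fredholm_det_eq_exp\<close>) rests on linear algebra in the finite-dimensional
  range of \<open>u\<close>. There is a basis of generalized eigenvectors in which \<open>u\<close> is triangular
  (\<open>gen_eigenbasis_exists\<close>); its diagonal entries are the eigenvalues with their algebraic
  multiplicities, and the sum of their \<open>n\<close>-th powers is the trace of \<open>u\<^sup>n\<close>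
  (\<open>finite_rank_spectral\<close>).\<close>

section \<open>The Hahn--Banach theorem\<close>

text \<open>Sublinear functionals over the real scalars. An inequality is enough for positive
  homogeneity: applied to the factors \<open>t\<close> and \<open>1 / t\<close> it gives equality.\<close>

definition real_sublinear :: "'a::complex_vector set \<Rightarrow> ('a \<Rightarrow> real) \<Rightarrow> bool" where
  "real_sublinear V p \<longleftrightarrow> (\<forall>x\<in>V. \<forall>y\<in>V. p (x + y) \<le> p x + p y) \<and>
     (\<forall>t>0. \<forall>x\<in>V. p (complex_of_real t *\<^sub>C x) \<le> t * p x)"

lemma real_sublinear_add: "real_sublinear V p \<Longrightarrow> x \<in> V \<Longrightarrow> y \<in> V \<Longrightarrow> p (x + y) \<le> p x + p y"
  by (simp add: real_sublinear_def)

lemma real_sublinear_scale_le: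
  "real_sublinear V p \<Longrightarrow> 0 < t \<Longrightarrow> x \<in> V \<Longrightarrow> p (complex_of_real t *\<^sub>C x) \<le> t * p x"
  by (simp add: real_sublinear_def)

lemma real_sublinear_zero:
  assumes p: "real_sublinear V p" and V: "cvs.subspace V"
  shows "p 0 = 0"
proof -
  have "p 0 \<le> t * p 0" if "t > 0" for t
    using real_sublinear_scale_le[OF p that cvs.subspace_0[OF V]] by simp
  from this[of 2] this[of "1/2"] show ?thesis by simp
qed

lemma real_sublinear_scale:
  assumes p: "real_sublinear V p" and V: "cvs.subspace V" and t: "0 \<le> t" and x: "x \<in> V"
  shows "p (complex_of_real t *\<^sub>C x) = t * p x"
proof (cases "t = 0")
  case True
  then show ?thesis using real_sublinear_zero[OF p V] by simp
next
  case False
  then have t: "t > 0" using t by simp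
  have "p (complex_of_real (1/t) *\<^sub>C (complex_of_real t *\<^sub>C x))
      \<le> (1/t) * p (complex_of_real t *\<^sub>C x)"
    using t x by (intro real_sublinear_scale_le[OF p]) (auto intro: cvs.subspace_scale[OF V])
  moreover have "complex_of_real (1/t) *\<^sub>C (complex_of_real t *\<^sub>C x) = x"
    using t by (simp add: scaleC_scaleC scaleC_one)
  ultimately have "t * p x \<le> p (complex_of_real t *\<^sub>C x)"
    using t by (simp add: field_simps)
  with real_sublinear_scale_le[OF p t x] show ?thesis by simp
qed

lemma real_sublinear_lower:
  assumes p: "real_sublinear V p" and V: "cvs.subspace V" and x: "x \<in> V" and z: "z \<in> V"
  shows "- p (- x) \<le> p (x + z) - p z"
proof -
  have "p z \<le> p (x + z) + p (- x)"
    using real_sublinear_add[OF p, of "x + z" "- x"] x z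
    by (simp add: cvs.subspace_add[OF V] cvs.subspace_neg[OF V])
  then show ?thesis by simp
qed

text \<open>The minorant is the infimum of \<open>p (x + t a) - t p a\<close> over \<open>t \<ge> 0\<close>. If it equals \<open>p\<close>, then
  \<open>p (x + a) = p x + p a\<close> for all \<open>x\<close>.\<close>

lemma real_sublinear_minorant:
  assumes p: "real_sublinear V p" and V: "cvs.subspace V" and a: "a \<in> V"
  obtains p' where "real_sublinear V p'" "\<And>x. x \<in> V \<Longrightarrow> p' x \<le> p x"
    "\<And>x. x \<in> V \<Longrightarrow> p' x \<le> p (x + a) - p a" "\<And>x. x \<notin> V \<Longrightarrow> p' x = 0"
proof -
  let ?s = "\<lambda>t. complex_of_real t *\<^sub>C a"
  have sV: "?s t \<in> V" for t using cvs.subspace_scale[OF V a] .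
  define F where "F x t = p (x + ?s t) - t * p a" for x t
  define p' where "p' x = (if x \<in> V then INF t\<in>{0..}. F x t else 0)" for x
  have bdd: "bdd_below (F x ` {0..})" if x: "x \<in> V" for x
  proof (rule bdd_belowI2)
    fix t :: real assume "t \<in> {0..}"
    then show "- p (- x) \<le> F x t"
      using real_sublinear_lower[OF p V x sV[of t]] real_sublinear_scale[OF p V _ a, of t]
      by (simp add: F_def)
  qed
  have le: "p' x \<le> F x t" if "x \<in> V" "t \<ge> 0" for x t
    unfolding p'_def using that by (auto intro!: cINF_lower[OF bdd])
  have ge: "c \<le> p' x" if "x \<in> V" "\<And>t. t \<ge> 0 \<Longrightarrow> c \<le> F x t" for c x
    unfolding p'_def using that by (auto intro!: cINF_greatest)
  have subl: "real_sublinear V p'"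
    unfolding real_sublinear_def
  proof (intro conjI ballI allI impI)
    fix x y assume x: "x \<in> V" and y: "y \<in> V"
    have xy: "x + y \<in> V" using cvs.subspace_add[OF V x y] .
    have "p' (x + y) - F x s \<le> F y t" if "s \<ge> 0" "t \<ge> 0" for s t
    proof -
      have eq: "x + y + ?s (s + t) = (x + ?s s) + (y + ?s t)"
        by (simp add: scaleC_add_left algebra_simps)
      have "p (x + y + ?s (s + t)) \<le> p (x + ?s s) + p (y + ?s t)"
        unfolding eq using x y sV by (intro real_sublinear_add[OF p] cvs.subspace_add[OF V])
      then have "F (x + y) (s + t) \<le> F x s + F y t" by (simp add: F_def algebra_simps)
      with le[OF xy, of "s + t"] that show ?thesis by simp
    qed
    then have "p' (x + y) - F x s \<le> p' y" if "s \<ge> 0" for s using that y by (intro ge) auto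
    then have "p' (x + y) - p' y \<le> p' x" using x by (intro ge) (auto simp: algebra_simps)
    then show "p' (x + y) \<le> p' x + p' y" by simp
  next
    fix c x assume c: "0 < (c::real)" and x: "x \<in> V"
    let ?c = "complex_of_real c"
    have cx: "?c *\<^sub>C x \<in> V" using cvs.subspace_scale[OF V x] .
    have "p' (?c *\<^sub>C x) / c \<le> F x t" if t: "t \<ge> 0" for t
    proof -
      have "?c *\<^sub>C x + ?s (c * t) = ?c *\<^sub>C (x + ?s t)"
        by (simp add: scaleC_add_right scaleC_scaleC)
      then have "p (?c *\<^sub>C x + ?s (c * t)) \<le> c * p (x + ?s t)"
        using x sV c by (simp add: real_sublinear_scale_le[OF p] cvs.subspace_add[OF V])
      then have "F (?c *\<^sub>C x) (c * t) \<le> c * F x t" by (simp add: F_def algebra_simps)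
      with le[OF cx, of "c * t"] c t have "p' (?c *\<^sub>C x) \<le> c * F x t" by simp
      then show ?thesis using c by (simp add: field_simps)
    qed
    then have "p' (?c *\<^sub>C x) / c \<le> p' x" using x by (intro ge)
    then show "p' (?c *\<^sub>C x) \<le> c * p' x" using c by (simp add: field_simps)
  qed
  show thesis
  proof (rule that[OF subl])
    show "p' x \<le> p x" if "x \<in> V" for x using le[OF that, of 0] by (simp add: F_def)
    show "p' x \<le> p (x + a) - p a" if "x \<in> V" for x
      using le[OF that, of 1] by (simp add: F_def scaleC_one)
  qed (simp add: p'_def)
qed

text \<open>By Zorn's lemma there is a minimal sublinear functional below \<open>p\<close>; it equals each of its
  minorants in the preceding lemma and is therefore linear.\<close>

lemma real_Hahn_Banach:
  assumes p: "real_sublinear V p" and V: "cvs.subspace V"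
  obtains g where "\<And>x. x \<in> V \<Longrightarrow> g x \<le> p x"
    "\<And>x y. x \<in> V \<Longrightarrow> y \<in> V \<Longrightarrow> g (x + y) = g x + g y"
    "\<And>t x. x \<in> V \<Longrightarrow> g (complex_of_real t *\<^sub>C x) = t * g x"
proof -
  \<comment> \<open>Functionals are normalized to be 0 off \<open>V\<close>, so that the pointwise order is antisymmetric.\<close>
  define S where "S = {g. real_sublinear V g \<and> (\<forall>x\<in>V. g x \<le> p x) \<and> (\<forall>x. x \<notin> V \<longrightarrow> g x = 0)}"
  have S_lower: "- p (- x) \<le> g x" if "g \<in> S" "x \<in> V" for g x
  proof -
    have g: "real_sublinear V g" and "g (- x) \<le> p (- x)"
      using that cvs.subspace_neg[OF V] by (auto simp: S_def)
    then show ?thesis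
      using real_sublinear_lower[OF g V that(2) cvs.subspace_0[OF V]] real_sublinear_zero[OF g V]
      by simp
  qed
  have p0: "(\<lambda>x. if x \<in> V then p x else 0) \<in> S"
    using p cvs.subspace_add[OF V] cvs.subspace_scale[OF V]
    by (auto simp: S_def real_sublinear_def)
  have "\<exists>m\<in>S. \<forall>g\<in>S. g \<le> m \<longrightarrow> g = m"
  proof (rule predicate_Zorn)
    show "partial_order_on S (relation_of (\<lambda>g h. h \<le> g) S)"
      by (intro partial_order_on_relation_ofI) auto
  next
    fix C assume C: "C \<in> Chains (relation_of (\<lambda>g h. h \<le> g) S)"
    then have CS: "C \<subseteq> S" and total: "g \<in> C \<Longrightarrow> h \<in> C \<Longrightarrow> g \<le> h \<or> h \<le> g" for g h
      unfolding Chains_def relation_of_def by auto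
    show "\<exists>u\<in>S. \<forall>g\<in>C. u \<le> g"
    proof (cases "C = {}")
      case True
      then show ?thesis using p0 by auto
    next
      case False
      define m where "m x = (if x \<in> V then INF g\<in>C. g x else 0)" for x
      have m_le: "m x \<le> g x" if "g \<in> C" for x g
      proof (cases "x \<in> V")
        case True
        have "bdd_below ((\<lambda>g. g x) ` C)" using S_lower CS True by (auto intro!: bdd_belowI2)
        then show ?thesis using True that by (auto simp: m_def intro!: cINF_lower)
      next
        case False
        then show ?thesis using that CS by (auto simp: m_def S_def)
      qed
      have m_ge: "c \<le> m x" if "x \<in> V" "\<And>g. g \<in> C \<Longrightarrow> c \<le> g x" for c x
        using that False by (auto simp: m_def intro!: cINF_greatest)
      have "real_sublinear V m"
        unfolding real_sublinear_def
      proof (intro conjI ballI allI impI)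
        fix x y assume x: "x \<in> V" and y: "y \<in> V"
        have "m (x + y) - g x \<le> h y" if gh: "g \<in> C" "h \<in> C" for g h
        proof -
          obtain k where k: "k \<in> C" "k \<le> g" "k \<le> h" using total[OF gh] gh by (metis order_refl)
          have "m (x + y) \<le> k (x + y)" using m_le k by blast
          also have "\<dots> \<le> k x + k y" using k CS x y by (auto simp: S_def real_sublinear_def)
          also have "\<dots> \<le> g x + h y" using k by (auto simp: le_fun_def intro: add_mono)
          finally show ?thesis by simp
        qed
        then have "m (x + y) - g x \<le> m y" if "g \<in> C" for g using that y by (intro m_ge) auto
        then have "m (x + y) - m y \<le> m x" using x by (intro m_ge) (auto simp: algebra_simps)
        then show "m (x + y) \<le> m x + m y" by simp
      next
        fix c x assume c: "0 < (c::real)" and x: "x \<in> V"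
        have "m (complex_of_real c *\<^sub>C x) / c \<le> g x" if g: "g \<in> C" for g
        proof -
          have "g (complex_of_real c *\<^sub>C x) \<le> c * g x"
            using g CS c x by (auto simp: S_def real_sublinear_def)
          with m_le[OF g, of "complex_of_real c *\<^sub>C x"] c show ?thesis by (simp add: field_simps)
        qed
        then have "m (complex_of_real c *\<^sub>C x) / c \<le> m x" using x by (intro m_ge)
        then show "m (complex_of_real c *\<^sub>C x) \<le> c * m x" using c by (simp add: field_simps)
      qed
      moreover have "m x \<le> p x" if x: "x \<in> V" for x
      proof -
        obtain g where g: "g \<in> C" using False by blast
        then have "g x \<le> p x" using CS x by (auto simp: S_def)
        with m_le[OF g, of x] show ?thesis by simp
      qed
      ultimately have "m \<in> S" by (simp add: S_def m_def)
      then show ?thesis using m_le by (auto simp: le_fun_def)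
    qed
  qed
  then obtain g where g: "g \<in> S" and min: "\<And>h. h \<in> S \<Longrightarrow> h \<le> g \<Longrightarrow> h = g" by blast
  have gs: "real_sublinear V g" and gp: "\<And>x. x \<in> V \<Longrightarrow> g x \<le> p x" and g0: "\<And>x. x \<notin> V \<Longrightarrow> g x = 0"
    using g by (auto simp: S_def)
  have add: "g (x + a) = g x + g a" if x: "x \<in> V" and a: "a \<in> V" for x a
  proof -
    obtain h where h: "real_sublinear V h" "\<And>x. x \<in> V \<Longrightarrow> h x \<le> g x"
      "\<And>x. x \<in> V \<Longrightarrow> h x \<le> g (x + a) - g a" "\<And>x. x \<notin> V \<Longrightarrow> h x = 0"
      using real_sublinear_minorant[OF gs V a] by metis
    have "h \<in> S" using h gp by (force simp: S_def)
    moreover have "h \<le> g"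
    proof (rule le_funI)
      show "h x \<le> g x" for x by (cases "x \<in> V") (simp_all add: h g0)
    qed
    ultimately have "h = g" by (rule min)
    then have "g x + g a \<le> g (x + a)" using h(3)[OF x] by simp
    with real_sublinear_add[OF gs x a] show ?thesis by simp
  qed
  have neg: "g (- x) = - g x" if x: "x \<in> V" for x
    using add[OF x cvs.subspace_neg[OF V x]] real_sublinear_zero[OF gs V] by simp
  have scale: "g (complex_of_real t *\<^sub>C x) = t * g x" if x: "x \<in> V" for t x
  proof (cases "t \<ge> 0")
    case True
    then show ?thesis using real_sublinear_scale[OF gs V _ x] by simp
  next
    case False
    then have "g (complex_of_real (- t) *\<^sub>C x) = - t * g x"
      using real_sublinear_scale[OF gs V _ x, of "- t"] by simp
    moreover have "g (complex_of_real t *\<^sub>C x) = g (- (complex_of_real (- t) *\<^sub>C x))"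
      by simp
    moreover have "\<dots> = - g (complex_of_real (- t) *\<^sub>C x)"
      by (rule neg[OF cvs.subspace_scale[OF V x]])
    ultimately show ?thesis by linarith
  qed
  show thesis by (rule that[OF gp add scale])
qed

context complex_banach
begin

lemma nrm_nonneg': "0 \<le> nrm X x"
  by (cases "x \<in> carr X") (simp_all add: nrm_nonneg nrm_outside)

lemma nrm_zero: "nrm X 0 = 0"
  using nrm_eq_0_iff[OF cvs.subspace_0[OF subspace_carr]] by simp

text \<open>The complex Hahn--Banach theorem, for a single vector.\<close>

lemma norming_functional:
  assumes y: "y \<in> carr X"
  obtains f where "f \<in> dual_space X" "\<And>x. x \<in> carr X \<Longrightarrow> cmod (f x) \<le> nrm X x"
    "cmod (f y) = nrm X y"
proof -
  let ?V = "carr X"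
  note V = subspace_carr
  have p: "real_sublinear ?V (nrm X)"
    by (simp add: real_sublinear_def nrm_triangle nrm_scaleC)
  \<comment> \<open>Passing to a minorant in the direction \<open>y\<close> forces \<open>g y \<ge> nrm X y\<close> below.\<close>
  obtain p' where p': "real_sublinear ?V p'" "\<And>x. x \<in> ?V \<Longrightarrow> p' x \<le> nrm X x"
    "\<And>x. x \<in> ?V \<Longrightarrow> p' x \<le> nrm X (x + y) - nrm X y"
    using real_sublinear_minorant[OF p V y] by metis
  obtain g where g: "\<And>x. x \<in> ?V \<Longrightarrow> g x \<le> p' x"
    "\<And>x y. x \<in> ?V \<Longrightarrow> y \<in> ?V \<Longrightarrow> g (x + y) = g x + g y"
    "\<And>t x. x \<in> ?V \<Longrightarrow> g (complex_of_real t *\<^sub>C x) = t * g x"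
    using real_Hahn_Banach[OF p'(1) V] by blast
  have V_scale: "c *\<^sub>C x \<in> ?V" if "x \<in> ?V" for c x using cvs.subspace_scale[OF V that] .
  have V_add: "x + z \<in> ?V" if "x \<in> ?V" "z \<in> ?V" for x z using cvs.subspace_add[OF V that] .
  have gn: "g x \<le> nrm X x" if "x \<in> ?V" for x using g(1)[OF that] p'(2)[OF that] by simp
  have g_neg: "g (- x) = - g x" if "x \<in> ?V" for x using g(3)[OF that, of "-1"] by (simp add: scaleC_one)
  have gy: "nrm X y \<le> g y"
    using g(1)[of "- y"] p'(3)[of "- y"] g_neg[OF y] cvs.subspace_neg[OF V y] by (simp add: nrm_zero)
  \<comment> \<open>The complex linear functional with real part \<open>g\<close>.\<close>
  define f where "f x = (if x \<in> ?V then Complex (g x) (- g (\<i> *\<^sub>C x)) else 0)" for x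
  have f_add: "f (x + z) = f x + f z" if "x \<in> ?V" "z \<in> ?V" for x z
    using that by (simp add: f_def V_add g(2) V_scale scaleC_add_right complex_eq_iff)
  have f_scale: "f (c *\<^sub>C x) = c * f x" if x: "x \<in> ?V" for c x
  proof -
    have split: "g (c *\<^sub>C z) = Re c * g z + Im c * g (\<i> *\<^sub>C z)" if z: "z \<in> ?V" for c z
    proof -
      have "c *\<^sub>C z = complex_of_real (Re c) *\<^sub>C z + complex_of_real (Im c) *\<^sub>C (\<i> *\<^sub>C z)"
        by (simp add: scaleC_scaleC flip: scaleC_add_left) (simp add: complex_eq mult.commute)
      then have "g (c *\<^sub>C z) = g (complex_of_real (Re c) *\<^sub>C z)
          + g (complex_of_real (Im c) *\<^sub>C (\<i> *\<^sub>C z))"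
        using g(2)[OF V_scale[OF z] V_scale[OF V_scale[OF z]]] by simp
      then show ?thesis unfolding g(3)[OF z] g(3)[OF V_scale[OF z]] .
    qed
    have "g (\<i> *\<^sub>C (\<i> *\<^sub>C x)) = - g x" using g_neg[OF x] by (simp add: scaleC_scaleC scaleC_one)
    moreover have "\<i> *\<^sub>C (c *\<^sub>C x) = c *\<^sub>C (\<i> *\<^sub>C x)" by (simp add: scaleC_scaleC mult.commute)
    ultimately show ?thesis
      using x split[OF x, of c] split[OF V_scale[OF x, of \<i>], of c] by (simp add: f_def V_scale complex_eq_iff mult.commute[of c \<i>])
  qed
  have f_le: "cmod (f x) \<le> nrm X x" if x: "x \<in> ?V" for x
  proof (cases "f x = 0")
    case True
    then show ?thesis by (simp add: nrm_nonneg')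
  next
    case False
    \<comment> \<open>Rotating \<open>x\<close> makes \<open>f x\<close> real without changing the norm.\<close>
    define c where "c = cnj (f x) / cmod (f x)"
    have c1: "cmod c = 1" using False by (simp add: c_def norm_divide)
    have "f (c *\<^sub>C x) = cmod (f x)"
      using False by (simp add: f_scale[OF x] c_def complex_norm_square[symmetric] power2_eq_square
          mult.commute)
    then have "cmod (f x) = Re (f (c *\<^sub>C x))" by simp
    also have "\<dots> = g (c *\<^sub>C x)" using V_scale[OF x] by (simp add: f_def)
    also have "\<dots> \<le> nrm X x" using gn[OF V_scale[OF x], of c] x by (simp add: nrm_scaleC c1)
    finally show ?thesis .
  qed
  show thesis
  proof (rule that)
    show "f \<in> dual_space X"
      unfolding dual_space_def
    proof (intro CollectI conjI ballI allI impI exI[of _ 1])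
      show "cmod (f x) \<le> 1 * nrm X x" if "x \<in> ?V" for x using f_le[OF that] by simp
    qed (simp_all add: f_add f_scale, simp add: f_def)
    show "cmod (f y) = nrm X y"
    proof (rule antisym)
      have "nrm X y \<le> Re (f y)" using gy y by (simp add: f_def)
      also have "\<dots> \<le> cmod (f y)" by (rule complex_Re_le_cmod)
      finally show "nrm X y \<le> cmod (f y)" .
    qed (rule f_le[OF y])
  qed (rule f_le)
qed

end

section \<open>The quasinorm dominates the operator norm\<close>

text \<open>The line through \<open>x\<close> with the norm of \<open>X\<close>: for \<open>x \<noteq> 0\<close> in \<open>X\<close>, a copy of the scalar field in the
  universe.\<close>

definition line_space :: "'a::complex_vector nspace \<Rightarrow> 'a \<Rightarrow> 'a nspace" where
  "line_space X x =
     \<lparr>carr = cvs.span {x}, nrm = (\<lambda>z. if z \<in> cvs.span {x} then nrm X z else 0)\<rparr>"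

lemma carr_line_space: "carr (line_space X x) = range (\<lambda>c. c *\<^sub>C x)"
  by (simp add: line_space_def cvs.span_singleton)

lemma (in complex_banach) nrm_line_space:
  "x \<in> carr X \<Longrightarrow> nrm (line_space X x) (c *\<^sub>C x) = cmod c * nrm X x"
  by (simp add: line_space_def cvs.span_base cvs.span_scale nrm_scaleC)

lemma (in complex_banach) complex_banach_line_space:
  assumes x: "x \<in> carr X" "x \<noteq> 0"
  shows "complex_banach (line_space X x)"
proof -
  let ?K = "line_space X x"
  have sub: "cvs.subspace (carr ?K)" by (simp add: line_space_def)
  have in_X: "carr ?K \<subseteq> carr X"
    using x cvs.subspace_scale[OF subspace_carr] by (auto simp: carr_line_space)
  have nrm: "nrm ?K z = nrm X z" if "z \<in> carr ?K" for z
    using that by (simp add: line_space_def)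
  have pos: "0 < nrm X x" using x nrm_eq_0_iff nrm_nonneg by force
  have d: "nrm ?K (a *\<^sub>C x - b *\<^sub>C x) = cmod (a - b) * nrm X x" for a b
    using nrm_line_space[OF x(1), of "a - b"] by (simp add: cvs.scale_left_diff_distrib)
  have ms: "Metric_space (carr ?K) (\<lambda>x y. nrm ?K (x - y))"
  proof -
    interpret Metric_space "carr X" "\<lambda>x y. nrm X (x - y)" by (rule Metric_space_nrm)
    have "Metric_space (carr ?K) (\<lambda>x y. nrm X (x - y))" by (rule subspace[OF in_X])
    moreover have "nrm ?K (y - z) = nrm ?K (z - y)" "0 \<le> nrm ?K (y - z)" for y z
      using commute[of y z] nonneg[of y z] cvs.span_neg[of "y - z" "{x}"] cvs.span_neg[of "z - y" "{x}"]
      by (auto simp: line_space_def)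
    ultimately show ?thesis
      using cvs.subspace_diff[OF sub] by (auto simp: Metric_space_def nrm)
  qed
  show ?thesis
  proof
    show "Metric_space.mcomplete (carr ?K) (\<lambda>x y. nrm ?K (x - y))"
      unfolding Metric_space.mcomplete_def[OF ms]
    proof (intro allI impI)
      fix \<sigma> assume \<sigma>: "Metric_space.MCauchy (carr ?K) (\<lambda>x y. nrm ?K (x - y)) \<sigma>"
      then have "\<sigma> n \<in> carr ?K" for n unfolding Metric_space.MCauchy_def[OF ms] by blast
      then have "\<forall>n. \<exists>c. \<sigma> n = c *\<^sub>C x" by (auto simp: carr_line_space)
      then obtain c where c: "\<And>n. \<sigma> n = c n *\<^sub>C x" by metis
      have "Cauchy c"
        unfolding Cauchy_def
      proof (intro allI impI)
        fix e :: real assume "e > 0"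
        then have "e * nrm X x > 0" using pos by simp
        then obtain N where "\<And>m n. N \<le> m \<Longrightarrow> N \<le> n \<Longrightarrow> nrm ?K (\<sigma> m - \<sigma> n) < e * nrm X x"
          using \<sigma> unfolding Metric_space.MCauchy_def[OF ms] by blast
        then show "\<exists>M. \<forall>m\<ge>M. \<forall>n\<ge>M. dist (c m) (c n) < e"
          using pos by (auto simp: c d dist_norm)
      qed
      then obtain l where l: "c \<longlonglongrightarrow> l" using Cauchy_convergent_iff convergent_def by blast
      have "limitin (Metric_space.mtopology (carr ?K) (\<lambda>x y. nrm ?K (x - y))) \<sigma> (l *\<^sub>C x) sequentially"
        unfolding Metric_space.limit_metric_sequentially[OF ms]
      proof (intro conjI allI impI)
        fix e :: real assume "e > 0"
        then have "e / nrm X x > 0" using pos by simp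
        then obtain N where "\<And>n. n \<ge> N \<Longrightarrow> cmod (c n - l) < e / nrm X x"
          using l unfolding LIMSEQ_iff by blast
        then show "\<exists>N. \<forall>n\<ge>N. \<sigma> n \<in> carr ?K \<and> nrm ?K (\<sigma> n - l *\<^sub>C x) < e"
          using pos by (fastforce simp: c d carr_line_space field_simps)
      qed (auto simp: carr_line_space)
      then show "\<exists>y. limitin (Metric_space.mtopology (carr ?K) (\<lambda>x y. nrm ?K (x - y))) \<sigma> y sequentially"
        by blast
    qed
  next
    show "nrm ?K y = 0" if "y \<notin> carr ?K" for y using that by (simp add: line_space_def)
  next
    show "nrm ?K (y + z) \<le> nrm ?K y + nrm ?K z" if "y \<in> carr ?K" "z \<in> carr ?K" for y z
      using that in_X cvs.subspace_add[OF sub that] by (auto simp: nrm intro: nrm_triangle)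
  next
    show "nrm ?K (c *\<^sub>C y) = cmod c * nrm ?K y" if "y \<in> carr ?K" for c y
      using that in_X cvs.subspace_scale[OF sub that] by (auto simp: nrm nrm_scaleC)
  qed (use in_X sub in \<open>auto simp: nrm nrm_nonneg nrm_eq_0_iff\<close>)
qed

lemma op_nrm_le:
  assumes X: "complex_banach X" and M: "0 \<le> M" and T: "\<And>x. x \<in> carr X \<Longrightarrow> nrm Y (T x) \<le> M * nrm X x"
  shows "op_nrm X Y T \<le> M"
  unfolding op_nrm_def
proof (rule cSUP_least)
  show "{x \<in> carr X. nrm X x \<le> 1} \<noteq> {}"
    using complex_banach.nrm_zero[OF X] cvs.subspace_0[OF complex_banach.subspace_carr[OF X]] by auto
  fix x assume "x \<in> {x \<in> carr X. nrm X x \<le> 1}"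
  then show "nrm Y (T x) \<le> M" using T[of x] mult_left_mono[of "nrm X x" 1 M] M by auto
qed

lemma op_nrm_nonneg:
  assumes X: "complex_banach X" and Y: "complex_banach Y" and T: "T \<in> bounded_ops X Y"
  shows "0 \<le> op_nrm X Y T"
proof -
  note 0 = cvs.subspace_0[OF complex_banach.subspace_carr[OF X]]
  obtain M where M: "\<And>x. x \<in> carr X \<Longrightarrow> nrm Y (T x) \<le> M * nrm X x"
    using T unfolding bounded_ops_def by blast
  have "bdd_above ((\<lambda>x. nrm Y (T x)) ` {x \<in> carr X. nrm X x \<le> 1})"
  proof (rule bdd_aboveI2)
    fix x assume x: "x \<in> {x \<in> carr X. nrm X x \<le> 1}"
    have "nrm Y (T x) \<le> M * nrm X x" using M x by simp
    also have "\<dots> \<le> \<bar>M\<bar> * 1"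
      using x complex_banach.nrm_nonneg'[OF X, of x] by (intro mult_mono) auto
    finally show "nrm Y (T x) \<le> \<bar>M\<bar>" by simp
  qed
  then have "nrm Y (T 0) \<le> op_nrm X Y T"
    unfolding op_nrm_def using 0 by (intro cSUP_upper) (simp_all add: complex_banach.nrm_zero[OF X])
  then show ?thesis using complex_banach.nrm_nonneg'[OF Y, of "T 0"] by linarith
qed

text \<open>The quasinorm dominates the operator norm. Compressing \<open>u\<close> to the line through \<open>x\<close> by means of
  a functional that norms \<open>u x\<close> reduces this to \<open>q K K (id_op K) = 1\<close>.\<close>

lemma (in quasinormed_operator_ideal) nrm_le_quasinorm:
  assumes X: "complex_banach X" and Y: "complex_banach Y" and u: "u \<in> A X Y" and x: "x \<in> carr X"
  shows "nrm Y (u x) \<le> q X Y u * nrm X x"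
proof (cases "u x = 0")
  case True
  then show ?thesis
    using q_nonneg[OF X Y u] complex_banach.nrm_nonneg'[OF X, of x] complex_banach.nrm_zero[OF Y]
    by simp
next
  case False
  have uB: "u \<in> bounded_ops X Y" using ideal_subset[OF X Y] u by blast
  then have u_scale: "u (c *\<^sub>C x) = c *\<^sub>C u x" and uY: "u x \<in> carr Y" for c
    using x by (auto simp: bounded_ops_def)
  have x0: "x \<noteq> 0" using False u_scale[of 0] by auto
  let ?K = "line_space X x" and ?nx = "nrm X x"
  have K: "complex_banach ?K" by (rule complex_banach.complex_banach_line_space[OF X x x0])
  have pos: "?nx > 0"
    using x x0 complex_banach.nrm_eq_0_iff[OF X] complex_banach.nrm_nonneg[OF X] by force
  have K_in_X: "carr ?K \<subseteq> carr X"
    using cvs.subspace_scale[OF complex_banach.subspace_carr[OF X] x] by (auto simp: carr_line_space)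
  have nrm_K: "nrm ?K (c *\<^sub>C x) = cmod c * ?nx" for c
    by (rule complex_banach.nrm_line_space[OF X x])
  obtain f where f: "f \<in> dual_space Y" "\<And>y. y \<in> carr Y \<Longrightarrow> cmod (f y) \<le> nrm Y y"
    "cmod (f (u x)) = nrm Y (u x)"
    using complex_banach.norming_functional[OF Y uY] by blast
  \<comment> \<open>\<open>T \<circ> u \<circ> S\<close> is a multiple of the identity on the line through \<open>x\<close>.\<close>
  define T where "T y = (f y / ?nx) *\<^sub>C x" for y
  have T_le: "nrm ?K (T y) \<le> 1 * nrm Y y" if "y \<in> carr Y" for y
    using f(2)[OF that] pos by (simp add: T_def nrm_K norm_divide)
  have T: "T \<in> bounded_ops Y ?K"
    unfolding bounded_ops_def
  proof (intro CollectI conjI ballI allI impI exI[of _ 1])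
    show "nrm ?K (T y) \<le> 1 * nrm Y y" if "y \<in> carr Y" for y using T_le[OF that] .
  qed (use f(1) in \<open>auto simp: T_def carr_line_space dual_space_def add_divide_distrib scaleC_add_left\<close>)
  let ?S = "id_op ?K"
  have S_le: "nrm X (?S z) \<le> 1 * nrm ?K z" if "z \<in> carr ?K" for z
    using that by (simp add: id_op_def line_space_def)
  have S: "?S \<in> bounded_ops ?K X"
    unfolding bounded_ops_def
  proof (intro CollectI conjI ballI allI impI exI[of _ 1])
    show "nrm X (?S z) \<le> 1 * nrm ?K z" if "z \<in> carr ?K" for z using S_le[OF that] .
  qed (use K_in_X cvs.subspace_add[OF complex_banach.subspace_carr[OF K]]
      cvs.subspace_scale[OF complex_banach.subspace_carr[OF K]] in \<open>auto simp: id_op_def\<close>)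
  let ?c = "f (u x) / ?nx"
  have eq: "T \<circ> u \<circ> ?S = (\<lambda>z. ?c *\<^sub>C id_op ?K z)"
  proof
    fix z
    show "(T \<circ> u \<circ> ?S) z = ?c *\<^sub>C id_op ?K z"
    proof (cases "z \<in> carr ?K")
      case True
      then obtain c where z: "z = c *\<^sub>C x" by (auto simp: carr_line_space)
      have "f (c *\<^sub>C u x) = c * f (u x)" using f(1) uY by (simp add: dual_space_def)
      then show ?thesis
        using True by (simp add: id_op_def z T_def u_scale mult.commute)
    next
      case False
      have "f (0 *\<^sub>C u x) = 0 * f (u x)" using f(1) uY unfolding dual_space_def by blast
      then show ?thesis using False u_scale[of 0] by (simp add: id_op_def T_def)
    qed
  qed
  have dim: "cvs.dim (carr ?K) = 1"
  proof (rule cvs.dim_unique)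
    show "{x} \<subseteq> carr ?K" by (simp add: line_space_def cvs.span_base)
    show "cvs.independent {x}" using x0 by simp
  qed (auto simp: line_space_def)
  have "cmod ?c * 1 = q ?K ?K (T \<circ> u \<circ> ?S)"
    using q_scaleC[OF K K ideal_id[OF K dim], of ?c] q_id[OF K dim] by (simp add: eq)
  also have "\<dots> \<le> op_nrm Y ?K T * q X Y u * op_nrm ?K X ?S"
    by (rule q_comp[OF K X Y K S u T])
  also have "\<dots> \<le> 1 * q X Y u * 1"
    using op_nrm_le[OF Y zero_le_one T_le] op_nrm_le[OF K zero_le_one S_le] q_nonneg[OF X Y u]
      op_nrm_nonneg[OF Y K T] op_nrm_nonneg[OF K X S]
    by (intro mult_mono) auto
  finally show ?thesis using pos by (simp add: norm_divide f(3) field_simps)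
qed

section \<open>Triangular bases of generalized eigenvectors\<close>

text \<open>Linear maps of the whole universe. Such maps may be iterated and shifted by multiples of the
  identity without regard to a domain.\<close>

locale complex_linear =
  fixes g :: "'a::complex_vector \<Rightarrow> 'a"
  assumes add: "g (x + y) = g x + g y"
    and scale: "g (c *\<^sub>C x) = c *\<^sub>C g x"
begin

lemma zero: "g 0 = 0"
  using scale[of 0 0] by simp

lemma neg: "g (- x) = - g x"
  using add[of x "- x"] zero by (simp add: eq_neg_iff_add_eq_0 add.commute)

lemma diff: "g (x - y) = g x - g y"
  using add[of x "- y"] by (simp add: neg)

text \<open>The operator \<open>g - \<mu>\<close>.\<close>

definition shift :: "complex \<Rightarrow> 'a \<Rightarrow> 'a" where
  "shift \<mu> x = g x - \<mu> *\<^sub>C x"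

lemma shift_add: "shift \<mu> (x + y) = shift \<mu> x + shift \<mu> y"
  by (simp add: shift_def add scaleC_add_right)

lemma shift_scale: "shift \<mu> (c *\<^sub>C x) = c *\<^sub>C shift \<mu> x"
  by (simp add: shift_def scale cvs.scale_right_diff_distrib scaleC_scaleC mult.commute)

lemma complex_linear_shift: "complex_linear (shift \<mu>)"
  by unfold_locales (rule shift_add shift_scale)+

lemma shift_diff: "shift \<mu> (x - y) = shift \<mu> x - shift \<mu> y"
  by (simp add: shift_def diff cvs.scale_right_diff_distrib)

lemma shift_zero: "shift \<mu> 0 = 0"
  by (simp add: shift_def zero)

lemma complex_linear_funpow: "complex_linear (g ^^ n)"
  by (induction n) (auto simp: complex_linear_def add scale)

lemma shift_funpow_add: "(shift \<mu> ^^ n) (x + y) = (shift \<mu> ^^ n) x + (shift \<mu> ^^ n) y"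
  and shift_funpow_scale: "(shift \<mu> ^^ n) (c *\<^sub>C x) = c *\<^sub>C (shift \<mu> ^^ n) x"
  and shift_funpow_zero: "(shift \<mu> ^^ n) 0 = 0"
proof -
  interpret h: complex_linear "shift \<mu>" by (rule complex_linear_shift)
  interpret hn: complex_linear "shift \<mu> ^^ n" by (rule h.complex_linear_funpow)
  show "(shift \<mu> ^^ n) (x + y) = (shift \<mu> ^^ n) x + (shift \<mu> ^^ n) y"
    "(shift \<mu> ^^ n) (c *\<^sub>C x) = c *\<^sub>C (shift \<mu> ^^ n) x"
    "(shift \<mu> ^^ n) 0 = 0"
    by (rule hn.add hn.scale hn.zero)+
qed

text \<open>All vectors annihilated by some power of \<open>g - \<mu>\<close>; it is the zero space if \<open>\<mu>\<close> is not an
  eigenvalue.\<close>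

definition gen_eigenspace :: "complex \<Rightarrow> 'a set" where
  "gen_eigenspace \<mu> = {x. \<exists>n. (shift \<mu> ^^ n) x = 0}"

lemma shift_funpow_eq_0_mono:
  assumes "(shift \<mu> ^^ m) x = 0" "m \<le> n"
  shows "(shift \<mu> ^^ n) x = 0"
proof -
  have "(shift \<mu> ^^ n) x = (shift \<mu> ^^ (n - m)) ((shift \<mu> ^^ m) x)"
    using assms(2) by (metis funpow_add comp_apply le_add_diff_inverse2)
  then show ?thesis using assms(1) by (simp add: shift_funpow_zero)
qed

lemma subspace_gen_eigenspace: "cvs.subspace (gen_eigenspace \<mu>)"
proof (rule cvs.subspaceI)
  show "0 \<in> gen_eigenspace \<mu>" unfolding gen_eigenspace_def using shift_funpow_zero by blast
next
  fix x y assume "x \<in> gen_eigenspace \<mu>" "y \<in> gen_eigenspace \<mu>"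
  then obtain m n where mn: "(shift \<mu> ^^ m) x = 0" "(shift \<mu> ^^ n) y = 0"
    by (auto simp: gen_eigenspace_def)
  have "(shift \<mu> ^^ max m n) (x + y) = 0"
    using shift_funpow_eq_0_mono[OF mn(1), of "max m n"] shift_funpow_eq_0_mono[OF mn(2), of "max m n"]
    by (simp add: shift_funpow_add)
  then show "x + y \<in> gen_eigenspace \<mu>" unfolding gen_eigenspace_def by blast
next
  fix c x assume "x \<in> gen_eigenspace \<mu>"
  then show "c *\<^sub>C x \<in> gen_eigenspace \<mu>" by (auto simp: gen_eigenspace_def shift_funpow_scale)
qed

lemma gen_eigenspace_Suc: "shift \<mu> x \<in> gen_eigenspace \<mu> \<Longrightarrow> x \<in> gen_eigenspace \<mu>"
  unfolding gen_eigenspace_def by (auto simp: funpow_swap1 intro: exI[of _ "Suc _"])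

text \<open>On the generalized eigenvectors for \<open>\<nu>\<close>, the operator \<open>g - \<mu>\<close> with \<open>\<mu> \<noteq> \<nu>\<close> is invertible.
  Only surjectivity is needed.\<close>

lemma gen_eigenvector_in_range_shift:
  assumes "(shift \<nu> ^^ n) x = 0" "\<nu> \<noteq> \<mu>" "cvs.subspace V" "g ` V \<subseteq> V" "x \<in> V"
  shows "\<exists>z\<in>V. x = shift \<mu> z"
  using assms(1,5)
proof (induction n arbitrary: x)
  case 0
  then show ?case using cvs.subspace_0[OF assms(3)] by (intro bexI[of _ 0]) (simp_all add: shift_zero)
next
  case (Suc n)
  have "shift \<nu> x \<in> V"
    using Suc.prems(2) assms(3,4) by (auto simp: shift_def intro!: cvs.subspace_diff cvs.subspace_scale)
  moreover have "(shift \<nu> ^^ n) (shift \<nu> x) = 0" using Suc.prems(1) by (simp add: funpow_swap1)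
  ultimately obtain z where z: "z \<in> V" "shift \<nu> x = shift \<mu> z" using Suc.IH by blast
  \<comment> \<open>\<open>g - \<mu> = (g - \<nu>) + (\<nu> - \<mu>)\<close>, so \<open>(\<nu> - \<mu>) x\<close> is the difference of two images.\<close>
  let ?w = "(1 / (\<nu> - \<mu>)) *\<^sub>C (x - z)"
  have "shift \<mu> x - shift \<mu> z = (\<nu> - \<mu>) *\<^sub>C x"
    unfolding z(2)[symmetric] by (simp add: shift_def cvs.scale_left_diff_distrib)
  then have "shift \<mu> ?w = x"
    using assms(2) by (simp add: shift_scale shift_diff)
  moreover have "?w \<in> V"
    using z Suc.prems(2) assms(3) by (intro cvs.subspace_scale cvs.subspace_diff) auto
  ultimately show ?case by metis
qed

text \<open>\<open>poly_act p x\<close> is \<open>p(g) x\<close>, evaluated by Horner's scheme.\<close>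

definition poly_act :: "complex poly \<Rightarrow> 'a \<Rightarrow> 'a" where
  "poly_act p x = fold_coeffs (\<lambda>a y. a *\<^sub>C x + g y) p 0"

lemma poly_act_0: "poly_act 0 x = 0"
  by (simp add: poly_act_def)

lemma poly_act_pCons: "poly_act (pCons a p) x = a *\<^sub>C x + g (poly_act p x)"
  by (cases "p = 0 \<and> a = 0") (auto simp: poly_act_def zero)

lemma poly_act_add: "poly_act (p + r) x = poly_act p x + poly_act r x"
  by (induction p r rule: poly_induct2)
    (simp_all add: poly_act_0 poly_act_pCons add scaleC_add_left algebra_simps)

lemma poly_act_smult: "poly_act (smult c p) x = c *\<^sub>C poly_act p x"
  by (induction p) (simp_all add: poly_act_0 poly_act_pCons scale scaleC_add_right scaleC_scaleC)

lemma poly_act_linear_factor: "poly_act ([:- \<mu>, 1:] * p) x = shift \<mu> (poly_act p x)"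
proof -
  have "[:- \<mu>, 1:] * p = smult (- \<mu>) p + pCons 0 p" by simp
  then show ?thesis by (simp only: poly_act_add poly_act_smult poly_act_pCons) (simp add: shift_def)
qed

lemma poly_act_monom: "poly_act (monom 1 n) x = (g ^^ n) x"
  by (induction n) (simp_all add: monom_0 monom_Suc poly_act_pCons poly_act_0 scaleC_one zero)

lemma poly_act_in_subspace:
  assumes "cvs.subspace F" "g ` F \<subseteq> F" "x \<in> F"
  shows "poly_act p x \<in> F"
proof (induction p)
  case 0
  then show ?case using assms by (simp add: poly_act_0 cvs.subspace_0)
next
  case (pCons a p)
  then show ?case
    using assms by (auto simp: poly_act_pCons intro!: cvs.subspace_add cvs.subspace_scale)
qed

text \<open>The first power \<open>(g ^^ k) x\<close> that depends linearly on the preceding ones gives the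
  polynomial; it exists because the space spanned by \<open>C\<close> has finite dimension.\<close>

lemma annihilating_poly:
  assumes C: "finite C" and F: "g ` cvs.span C \<subseteq> cvs.span C" and x: "x \<in> cvs.span C"
  obtains p where "p \<noteq> 0" "poly_act p x = 0"
proof -
  let ?S = "\<lambda>k. (\<lambda>i. (g ^^ i) x) ` {..<k}"
  have pow: "(g ^^ i) x \<in> cvs.span C" for i using F x by (induction i) auto
  have "\<exists>k. (g ^^ k) x \<in> cvs.span (?S k)"
  proof (rule ccontr)
    assume "\<not> ?thesis"
    then have new: "(g ^^ k) x \<notin> cvs.span (?S k)" for k by blast
    have "cvs.independent (?S k) \<and> card (?S k) = k" for k
    proof (induction k)
      case (Suc k)
      have "(g ^^ k) x \<notin> ?S k" using new[of k] cvs.span_base[of "(g ^^ k) x" "?S k"] by blast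
      with Suc new[of k] show ?case by (simp add: lessThan_Suc cvs.independent_insert)
    qed (simp add: cvs.independent_empty)
    moreover have "?S (Suc (card C)) \<subseteq> cvs.span C" using pow by auto
    ultimately show False
      using cvs.independent_span_bound[OF C, of "?S (Suc (card C))"] by (metis Suc_n_not_le_n)
  qed
  then obtain k where k: "(g ^^ k) x \<in> cvs.span (?S k)" by blast
  have "\<exists>p. coeff p k = 0 \<and> poly_act p x = y" if "y \<in> cvs.span (?S k)" for y
    using that
  proof (induction rule: cvs.span_induct_alt)
    case base
    show ?case by (rule exI[of _ 0]) (simp add: poly_act_0)
  next
    case (step c z y)
    then obtain p i where "coeff p k = 0" "poly_act p x = y" "i < k" "z = (g ^^ i) x" by auto
    then show ?case
      by (intro exI[of _ "smult c (monom 1 i) + p"])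
        (simp add: poly_act_add poly_act_smult poly_act_monom)
  qed
  then obtain p where p: "coeff p k = 0" "poly_act p x = (g ^^ k) x" using k by blast
  let ?p = "monom 1 k + smult (-1) p"
  have "coeff ?p k \<noteq> 0" using p by simp
  then have "?p \<noteq> 0" by auto
  moreover have "poly_act ?p x = 0"
    unfolding poly_act_add poly_act_smult poly_act_monom by (simp add: p scaleC_one)
  ultimately show thesis by (rule that)
qed

text \<open>The vector \<open>z\<close> represents an eigenvector of the operator induced by \<open>g\<close> on the quotient of
  \<open>F\<close> by \<open>V\<close>. The linear factors of \<open>p\<close> are applied to \<open>x\<close> one at a time; one of them is the first
  to move the vector into \<open>V\<close>.\<close>

lemma quotient_eigenvector:
  assumes F: "cvs.subspace F" "g ` F \<subseteq> F" and p: "p \<noteq> 0" "poly_act p x \<in> V"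
    and V: "cvs.subspace V" and x: "x \<in> F" "x \<notin> V"
  obtains z \<mu> where "z \<in> F" "z \<notin> V" "shift \<mu> z \<in> V"
proof -
  have "\<exists>z\<in>F. z \<notin> V \<and> (\<exists>\<mu>. shift \<mu> z \<in> V)"
    using p
  proof (induction "degree p" arbitrary: p)
    case 0
    then obtain c where c: "p = [:c:]" "c \<noteq> 0" by (metis degree_eq_zeroE pCons_eq_0_iff)
    with 0 have "c *\<^sub>C x \<in> V" by (simp add: poly_act_pCons poly_act_0 zero)
    then have "(1 / c) *\<^sub>C (c *\<^sub>C x) \<in> V" using V by (rule cvs.subspace_scale[rotated])
    then show ?case using c x by (simp add: scaleC_one)
  next
    case (Suc n)
    then have "\<not> constant (poly p)" by (simp add: constant_degree)
    then obtain \<mu> where "poly p \<mu> = 0" using fundamental_theorem_of_algebra by blast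
    then obtain r where r: "p = [:- \<mu>, 1:] * r" by (metis poly_eq_0_iff_dvd dvdE)
    show ?case
    proof (cases "poly_act r x \<in> V")
      case True
      have "r \<noteq> 0" using r Suc.prems by auto
      moreover have "degree p = degree [:- \<mu>, 1:] + degree r"
        unfolding r by (rule degree_mult_eq) (use \<open>r \<noteq> 0\<close> in auto)
      then have "n = degree r" using Suc.hyps(2) by simp
      ultimately show ?thesis using Suc.hyps(1) True by blast
    next
      case False
      then show ?thesis
        using Suc.prems(2) poly_act_in_subspace[OF F x(1), of r] unfolding r poly_act_linear_factor
        by blast
    qed
  qed
  then show thesis using that by blast
qed

end

text \<open>Bases \<open>B\<close> of generalized eigenvectors in which \<open>g\<close> is triangular: each new vector \<open>x\<close> is an
  eigenvector, for the eigenvalue \<open>l x\<close>, modulo the span of the previous ones. The order of the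
  basis is implicit in the derivation. Triangularity yields the traces of the powers of \<open>g\<close>,
  and generalized eigenvectors yield the multiplicities.\<close>

inductive gen_eigenbasis :: "('a::complex_vector \<Rightarrow> 'a) \<Rightarrow> ('a \<Rightarrow> complex) \<Rightarrow> 'a set \<Rightarrow> bool"
  for g l where
  empty: "gen_eigenbasis g l {}"
| insert: "gen_eigenbasis g l B \<Longrightarrow> x \<notin> cvs.span B \<Longrightarrow> complex_linear.shift g (l x) x \<in> cvs.span B \<Longrightarrow>
    x \<in> complex_linear.gen_eigenspace g (l x) \<Longrightarrow> gen_eigenbasis g l (insert x B)"

lemma gen_eigenbasis_cong:
  "gen_eigenbasis g l B \<Longrightarrow> (\<And>x. x \<in> B \<Longrightarrow> l x = l' x) \<Longrightarrow> gen_eigenbasis g l' B"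
proof (induction rule: gen_eigenbasis.induct)
  case (insert B x)
  then show ?case by (intro gen_eigenbasis.insert) auto
qed (rule gen_eigenbasis.empty)

lemma gen_eigenbasis_finite: "gen_eigenbasis g l B \<Longrightarrow> finite B"
  by (induction rule: gen_eigenbasis.induct) auto

lemma gen_eigenbasis_independent: "gen_eigenbasis g l B \<Longrightarrow> cvs.independent B"
proof (induction rule: gen_eigenbasis.induct)
  case (insert B x)
  show ?case by (rule cvs.independent_insertI[OF insert.hyps(2) insert.IH])
qed (rule cvs.independent_empty)

lemma gen_eigenbasis_gen_eigenspace:
  "gen_eigenbasis g l B \<Longrightarrow> b \<in> B \<Longrightarrow> b \<in> complex_linear.gen_eigenspace g (l b)"
  by (induction rule: gen_eigenbasis.induct) auto

context complex_linear
begin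

lemma shift_in_span_iff: 
  assumes "x \<in> cvs.span B" shows "shift \<mu> x \<in> cvs.span B \<longleftrightarrow> g x \<in> cvs.span B"
proof -
  have "\<mu> *\<^sub>C x \<in> cvs.span B" using assms by (rule cvs.span_scale)
  then show ?thesis
    unfolding shift_def using cvs.span_add[of "g x - \<mu> *\<^sub>C x" B "\<mu> *\<^sub>C x"] by (auto intro: cvs.span_diff)
qed

lemma gen_eigenbasis_invariant: "gen_eigenbasis g l B \<Longrightarrow> x \<in> cvs.span B \<Longrightarrow> g x \<in> cvs.span B"
proof (induction arbitrary: x rule: gen_eigenbasis.induct)
  case empty
  then show ?case by (simp add: zero)
next
  case (insert B b)
  have mono: "cvs.span B \<subseteq> cvs.span (insert b B)" by (rule cvs.span_mono) blast
  obtain k where k: "x - k *\<^sub>C b \<in> cvs.span B"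
    using insert.prems cvs.span_breakdown_eq by blast
  have "g b \<in> cvs.span (insert b B)"
    using shift_in_span_iff[of b "insert b B" "l b"] insert.hyps(3) mono by (auto simp: cvs.span_base)
  moreover have "g (x - k *\<^sub>C b) \<in> cvs.span (insert b B)" using insert.IH[OF k] mono by blast
  ultimately have "g (x - k *\<^sub>C b) + k *\<^sub>C g b \<in> cvs.span (insert b B)"
    by (intro cvs.span_add cvs.span_scale)
  then show ?case by (simp add: diff scale)
qed

text \<open>Every incomplete basis can be extended: an eigenvector modulo the span of \<open>B\<close> is
  corrected by an element of that span to become a generalized eigenvector.\<close>

lemma gen_eigenbasis_extend:
  assumes B: "gen_eigenbasis g l B" and C: "finite C" "g ` cvs.span C \<subseteq> cvs.span C"
    and BC: "B \<subseteq> cvs.span C" "\<not> cvs.span C \<subseteq> cvs.span B"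
  obtains l' x where "gen_eigenbasis g l' (insert x B)" "x \<in> cvs.span C" "x \<notin> cvs.span B"
proof -
  let ?F = "cvs.span C" and ?V = "cvs.span B"
  have VF: "?V \<subseteq> ?F" using BC(1) cvs.span_minimal[OF _ cvs.subspace_span] by blast
  obtain x0 where x0: "x0 \<in> ?F" "x0 \<notin> ?V" using BC(2) by blast
  obtain p where "p \<noteq> 0" "poly_act p x0 = 0" using annihilating_poly[OF C x0(1)] .
  then obtain y \<mu> where y: "y \<in> ?F" "y \<notin> ?V" "shift \<mu> y \<in> ?V"
    using quotient_eigenvector[OF cvs.subspace_span C(2) _ _ cvs.subspace_span x0, of p]
      cvs.span_zero by metis
  \<comment> \<open>Fitting's decomposition of the span into the kernel of a power of \<open>g - \<mu>\<close> and a range of \<open>g - \<mu>\<close>: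
    basis vectors with eigenvalue \<open>\<mu>\<close> lie in the former, all others in the latter.\<close>
  have "\<exists>k z. v = k + shift \<mu> z \<and> z \<in> ?V \<and> k \<in> gen_eigenspace \<mu>" if "v \<in> ?V" for v
    using that
  proof (induction rule: cvs.span_induct_alt)
    case base
    show ?case
      using cvs.subspace_0[OF subspace_gen_eigenspace] cvs.span_zero
      by (intro exI[of _ 0]) (simp add: shift_zero)
  next
    case (step c b v)
    then obtain k z where kz: "v = k + shift \<mu> z" "z \<in> ?V" "k \<in> gen_eigenspace \<mu>" by blast
    note bgen = gen_eigenbasis_gen_eigenspace[OF B step(1)]
    show ?case
    proof (cases "l b = \<mu>")
      case True
      have "c *\<^sub>C b + k \<in> gen_eigenspace \<mu>"
        using bgen True kz(3) subspace_gen_eigenspace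
        by (intro cvs.subspace_add cvs.subspace_scale) auto
      then show ?thesis using kz by (intro exI[of _ "c *\<^sub>C b + k"] exI[of _ z]) simp
    next
      case False
      obtain n where n: "(shift (l b) ^^ n) b = 0" using bgen by (auto simp: gen_eigenspace_def)
      have "g ` ?V \<subseteq> ?V" using gen_eigenbasis_invariant[OF B] by blast
      then obtain w where w: "w \<in> ?V" "b = shift \<mu> w"
        using gen_eigenvector_in_range_shift[OF n False cvs.subspace_span _ cvs.span_base[OF step(1)]]
        by blast
      have "c *\<^sub>C b + v = k + shift \<mu> (c *\<^sub>C w + z)"
        by (simp add: kz(1) shift_add shift_scale flip: w(2))
      moreover have "c *\<^sub>C w + z \<in> ?V" using w kz by (intro cvs.span_add cvs.span_scale)
      ultimately show ?thesis using kz(3) by blast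
    qed
  qed
  then obtain k z where kz: "shift \<mu> y = k + shift \<mu> z" "z \<in> ?V" "k \<in> gen_eigenspace \<mu>"
    using y(3) by blast
  \<comment> \<open>Correcting \<open>y\<close> by \<open>z\<close> makes it a generalized eigenvector.\<close>
  define x where "x = y - z"
  have xk: "shift \<mu> x = k" using kz(1) by (simp add: x_def shift_diff)
  have xF: "x \<in> ?F" unfolding x_def using y kz VF by (intro cvs.span_diff) auto
  have xV: "x \<notin> ?V"
  proof
    assume "x \<in> ?V"
    then have "x + z \<in> ?V" using kz(2) by (rule cvs.span_add)
    then show False using y(2) by (simp add: x_def)
  qed
  have "k = shift \<mu> y - shift \<mu> z" using kz(1) by simp
  moreover have "shift \<mu> z \<in> ?V"
    using gen_eigenbasis_invariant[OF B kz(2)] shift_in_span_iff[OF kz(2)] by simp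
  ultimately have kV: "k \<in> ?V" using y(3) by (simp add: cvs.span_diff)
  have "gen_eigenbasis g (l(x := \<mu>)) B"
    using B by (rule gen_eigenbasis_cong) (use xV cvs.span_base in auto)
  then have "gen_eigenbasis g (l(x := \<mu>)) (insert x B)"
    using xV xk kV gen_eigenspace_Suc[of \<mu> x] kz(3) by (intro gen_eigenbasis.insert) auto
  then show thesis using xF xV by (rule that)
qed

lemma gen_eigenbasis_exists:
  assumes C: "finite C" "g ` cvs.span C \<subseteq> cvs.span C"
  obtains l B where "gen_eigenbasis g l B" "cvs.span B = cvs.span C"
proof -
  let ?P = "\<lambda>k. \<exists>l B. gen_eigenbasis g l B \<and> B \<subseteq> cvs.span C \<and> card B = k"
  have "?P 0" using gen_eigenbasis.empty[of g] by fastforce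
  moreover have "k \<le> card C" if "?P k" for k
    using that cvs.independent_span_bound[OF C(1)] gen_eigenbasis_independent by blast
  ultimately have "\<exists>k. ?P k \<and> (\<forall>j. ?P j \<longrightarrow> j \<le> k)"
    using ex_has_greatest_nat[of ?P 0 "\<lambda>k. k" "Suc (card C)"] by (simp add: less_Suc_eq_le)
  then obtain k where k: "?P k" "\<And>j. ?P j \<Longrightarrow> j \<le> k" by blast
  then obtain l B where B: "gen_eigenbasis g l B" "B \<subseteq> cvs.span C" "card B = k" by blast
  have "cvs.span C \<subseteq> cvs.span B"
  proof (rule ccontr)
    assume "\<not> ?thesis"
    then obtain l' x where x: "gen_eigenbasis g l' (insert x B)" "x \<in> cvs.span C" "x \<notin> cvs.span B"
      using gen_eigenbasis_extend[OF B(1) C B(2)] by blast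
    have "x \<notin> B" using x(3) cvs.span_base by blast
    then have "card (insert x B) = Suc k" using B(3) gen_eigenbasis_finite[OF B(1)] by simp
    then have "Suc k \<le> k" using x B(2) by (intro k(2)) blast
    then show False by simp
  qed
  moreover have "cvs.span B \<subseteq> cvs.span C" using B(2) cvs.span_minimal[OF _ cvs.subspace_span] by blast
  ultimately show thesis using B that by blast
qed

text \<open>The diagonal entries of the triangular matrix of \<open>g ^^ n\<close> are the powers \<open>l b ^ n\<close>.\<close>

lemma gen_eigenbasis_funpow_trace:
  assumes "gen_eigenbasis g l B"
  shows "(\<Sum>b\<in>B. cvs.representation B ((g ^^ n) b) b) = (\<Sum>b\<in>B. l b ^ n)"
  using assms
proof (induction rule: gen_eigenbasis.induct)
  case (insert B x)
  let ?B = "insert x B"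
  have B: "finite B" "cvs.independent B" "cvs.independent ?B" "x \<notin> B" "x \<in> cvs.span ?B"
    using gen_eigenbasis_finite[OF insert.hyps(1)] gen_eigenbasis_independent[OF insert.hyps(1)]
      cvs.independent_insertI[OF insert.hyps(2)] insert.hyps(2) cvs.span_base by blast+
  have inv: "(g ^^ n) v \<in> cvs.span B" if "v \<in> cvs.span B" for n v
    using that by (induction n) (auto simp: gen_eigenbasis_invariant[OF insert.hyps(1)])
  have mono: "cvs.span B \<subseteq> cvs.span ?B" by (rule cvs.span_mono) blast
  have ext: "cvs.representation ?B v = cvs.representation B v" if "v \<in> cvs.span B" for v
    using cvs.representation_extend[OF B(3) that] by blast
  have "(g ^^ n) x - (l x ^ n) *\<^sub>C x \<in> cvs.span B"
  proof (induction n)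
    case 0
    show ?case by (simp add: scaleC_one cvs.span_zero)
  next
    case (Suc n)
    have "g ((g ^^ n) x) - (l x ^ Suc n) *\<^sub>C x
        = g ((g ^^ n) x - (l x ^ n) *\<^sub>C x) + (l x ^ n) *\<^sub>C shift (l x) x"
      by (simp add: diff scale shift_def cvs.scale_right_diff_distrib scaleC_scaleC mult.commute)
    then show ?case
      using gen_eigenbasis_invariant[OF insert.hyps(1) Suc] insert.hyps(3)
      by (auto intro!: cvs.span_add cvs.span_scale)
  qed
  then have v: "(g ^^ n) x - (l x ^ n) *\<^sub>C x \<in> cvs.span B" (is "?v \<in> _") .
  have "cvs.representation ?B ?v x = 0"
    using cvs.representation_ne_zero[of B ?v x] B(4) by (auto simp: ext[OF v])
  moreover have "cvs.representation ?B ((l x ^ n) *\<^sub>C x) x = l x ^ n"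
    using B(3,5) by (simp add: cvs.representation_scale cvs.representation_basis)
  moreover have "cvs.representation ?B (?v + (l x ^ n) *\<^sub>C x)
      = (\<lambda>b. cvs.representation ?B ?v b + cvs.representation ?B ((l x ^ n) *\<^sub>C x) b)"
    using v mono by (intro cvs.representation_add B(3) cvs.span_scale[OF B(5)]) auto
  ultimately have "cvs.representation ?B ((g ^^ n) x) x = l x ^ n" by simp
  moreover have "(\<Sum>b\<in>B. cvs.representation ?B ((g ^^ n) b) b)
      = (\<Sum>b\<in>B. cvs.representation B ((g ^^ n) b) b)"
    by (intro sum.cong refl) (simp add: ext inv cvs.span_base)
  ultimately show ?case using insert.IH B by simp
qed simp

lemma gen_eigenbasis_span_gen_eigenspace:
  assumes "gen_eigenbasis g l B" "y \<in> cvs.span B" "y \<in> gen_eigenspace \<mu>"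
  shows "y \<in> cvs.span {b \<in> B. l b = \<mu>}"
  using assms
proof (induction arbitrary: y rule: gen_eigenbasis.induct)
  case (insert B x)
  obtain c where c: "y - c *\<^sub>C x \<in> cvs.span B" (is "?z \<in> _")
    using insert.prems(1) cvs.span_breakdown_eq by blast
  have mono: "cvs.span {b \<in> B. l b = \<mu>} \<subseteq> cvs.span {b \<in> insert x B. l b = \<mu>}"
    by (rule cvs.span_mono) blast
  show ?case
  proof (cases "l x = \<mu>")
    case True
    then have "?z \<in> gen_eigenspace \<mu>"
      using insert.prems(2) insert.hyps(4) subspace_gen_eigenspace
      by (intro cvs.subspace_diff cvs.subspace_scale) auto
    then have "?z \<in> cvs.span {b \<in> insert x B. l b = \<mu>}" using insert.IH[OF c] mono by blast
    moreover have "c *\<^sub>C x \<in> cvs.span {b \<in> insert x B. l b = \<mu>}"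
      using True by (intro cvs.span_scale cvs.span_base) simp
    ultimately have "?z + c *\<^sub>C x \<in> cvs.span {b \<in> insert x B. l b = \<mu>}" by (rule cvs.span_add)
    then show ?thesis by simp
  next
    case False
    obtain n where n: "(shift \<mu> ^^ n) y = 0" using insert.prems(2) by (auto simp: gen_eigenspace_def)
    \<comment> \<open>Modulo the span of \<open>B\<close>, the operator \<open>g - \<mu>\<close> multiplies \<open>x\<close> by \<open>l x - \<mu> \<noteq> 0\<close>, so \<open>c = 0\<close>.\<close>
    have "(shift \<mu> ^^ n) y - (c * (l x - \<mu>) ^ n) *\<^sub>C x \<in> cvs.span B"
    proof (induction n)
      case 0
      show ?case using c by simp
    next
      case (Suc n)
      let ?w = "(shift \<mu> ^^ n) y - (c * (l x - \<mu>) ^ n) *\<^sub>C x" and ?k = "c * (l x - \<mu>) ^ n"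
      have "shift \<mu> x = shift (l x) x + (l x - \<mu>) *\<^sub>C x"
        by (simp add: shift_def cvs.scale_left_diff_distrib)
      then have "shift \<mu> (?w + ?k *\<^sub>C x)
          = shift \<mu> ?w + ?k *\<^sub>C (shift (l x) x + (l x - \<mu>) *\<^sub>C x)"
        by (simp only: shift_add shift_scale)
      also have "\<dots> = shift \<mu> ?w + ?k *\<^sub>C shift (l x) x + (c * (l x - \<mu>) ^ Suc n) *\<^sub>C x"
        by (simp add: scaleC_add_right scaleC_scaleC mult_ac)
      finally have "(shift \<mu> ^^ Suc n) y - (c * (l x - \<mu>) ^ Suc n) *\<^sub>C x
          = shift \<mu> ?w + ?k *\<^sub>C shift (l x) x" by simp
      moreover have "shift \<mu> ?w \<in> cvs.span B"
        using Suc gen_eigenbasis_invariant[OF insert.hyps(1) Suc] shift_in_span_iff by blast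
      ultimately show ?case using insert.hyps(3) by (auto intro!: cvs.span_add cvs.span_scale)
    qed
    then have "(c * (l x - \<mu>) ^ n) *\<^sub>C x \<in> cvs.span B"
      unfolding n using cvs.span_neg by fastforce
    then have "c = 0"
    proof (rule contrapos_pp)
      assume "c \<noteq> 0"
      define k where "k = c * (l x - \<mu>) ^ n"
      have "k \<noteq> 0" using \<open>c \<noteq> 0\<close> False by (simp add: k_def)
      then have "(1 / k) *\<^sub>C (k *\<^sub>C x) = x" by simp
      then show "(c * (l x - \<mu>) ^ n) *\<^sub>C x \<notin> cvs.span B"
        using insert.hyps(2) cvs.span_scale[of "k *\<^sub>C x" B "1 / k"] by (auto simp: k_def)
    qed
    then show ?thesis using insert.IH[of y] c insert.prems(2) mono by auto
  qed
qed simp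

end

section \<open>The ideal of finite rank operators\<close>

lemma bounded_opsD:
  assumes "T \<in> bounded_ops X Y"
  shows "x \<in> carr X \<Longrightarrow> T x \<in> carr Y" "x \<notin> carr X \<Longrightarrow> T x = 0"
    "x \<in> carr X \<Longrightarrow> z \<in> carr X \<Longrightarrow> T (x + z) = T x + T z"
    "x \<in> carr X \<Longrightarrow> T (c *\<^sub>C x) = c *\<^sub>C T x"
  using assms unfolding bounded_ops_def by blast+

lemma bounded_ops_bound:
  assumes "T \<in> bounded_ops X Y"
  obtains M where "\<And>x. x \<in> carr X \<Longrightarrow> nrm Y (T x) \<le> M * nrm X x"
  using assms unfolding bounded_ops_def by blast

context complex_banach
begin

lemma bounded_ops_zero:
  assumes "T \<in> bounded_ops X Y" shows "T 0 = 0"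
  using bounded_opsD(4)[OF assms cvs.subspace_0[OF subspace_carr], of 0] by simp

lemma bounded_ops_in_carr:
  assumes "T \<in> bounded_ops Y X" shows "T x \<in> carr X"
  using bounded_opsD(1,2)[OF assms, of x] cvs.subspace_0[OF subspace_carr] by fastforce

lemma bounded_ops_diff:
  assumes T: "T \<in> bounded_ops X Y" and x: "x \<in> carr X" and z: "z \<in> carr X"
  shows "T (x - z) = T x - T z"
proof -
  have "T (x - z + z) = T (x - z) + T z"
    by (rule bounded_opsD(3)[OF T cvs.subspace_diff[OF subspace_carr x z] z])
  then show ?thesis by simp
qed

lemma bounded_ops_sum:
  assumes T: "T \<in> bounded_ops X Y" and y: "\<And>k. k < (N::nat) \<Longrightarrow> y k \<in> carr X"
  shows "T (\<Sum>k<N. c k *\<^sub>C y k) = (\<Sum>k<N. c k *\<^sub>C T (y k))"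
  using y
proof (induction N)
  case 0
  then show ?case by (simp add: bounded_ops_zero[OF T])
next
  case (Suc N)
  have "(\<Sum>k<N. c k *\<^sub>C y k) \<in> carr X"
    using Suc.prems by (auto intro!: cvs.subspace_sum[OF subspace_carr] cvs.subspace_scale[OF subspace_carr])
  moreover have "y N \<in> carr X" using Suc.prems by simp
  ultimately show ?case
    using Suc by (simp add: bounded_opsD(3,4)[OF T] cvs.subspace_scale[OF subspace_carr])
qed

lemma bounded_ops_funpow_diff:
  assumes T: "T \<in> bounded_ops X X" and x: "x \<in> carr X" and z: "z \<in> carr X"
  shows "(T ^^ k) (x - z) = (T ^^ k) x - (T ^^ k) z"
proof -
  have in_carr: "(T ^^ k) v \<in> carr X" if "v \<in> carr X" for k v
    using that by (induction k) (auto intro: bounded_ops_in_carr[OF T])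
  show ?thesis by (induction k) (simp_all add: bounded_ops_diff[OF T] in_carr x z)
qed

lemma bounded_ops_comp:
  assumes S: "S \<in> bounded_ops X X" and T: "T \<in> bounded_ops X X"
  shows "T \<circ> S \<in> bounded_ops X X"
proof -
  obtain M where M: "\<And>x. x \<in> carr X \<Longrightarrow> nrm X (S x) \<le> M * nrm X x"
    using bounded_ops_bound[OF S] by blast
  obtain L where L: "\<And>x. x \<in> carr X \<Longrightarrow> nrm X (T x) \<le> L * nrm X x"
    using bounded_ops_bound[OF T] by blast
  have "nrm X (T (S x)) \<le> (\<bar>L\<bar> * M) * nrm X x" if x: "x \<in> carr X" for x
  proof -
    have "nrm X (T (S x)) \<le> L * nrm X (S x)" using L bounded_ops_in_carr[OF S] .
    also have "\<dots> \<le> \<bar>L\<bar> * nrm X (S x)" using nrm_nonneg' by (intro mult_right_mono) auto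
    also have "\<dots> \<le> \<bar>L\<bar> * (M * nrm X x)" using M[OF x] by (intro mult_left_mono) auto
    finally show ?thesis by (simp add: mult.assoc)
  qed
  then have "\<exists>M. \<forall>x\<in>carr X. nrm X ((T \<circ> S) x) \<le> M * nrm X x" by auto
  then show ?thesis
    unfolding bounded_ops_def
    by (simp add: bounded_opsD[OF S] bounded_opsD[OF T] bounded_ops_zero[OF T])
qed

lemma finite_rank_ops_left:
  assumes w: "w \<in> finite_rank_ops X" and T: "T \<in> bounded_ops X X"
  shows "T \<circ> w \<in> finite_rank_ops X"
proof -
  obtain N f y where rep: "finite_rep X w N f y" using w by (auto simp: finite_rank_ops_def)
  then have "finite_rep X (T \<circ> w) N f (T \<circ> y)"
    using bounded_opsD(1)[OF T] by (auto simp: finite_rep_def fun_eq_iff bounded_ops_sum[OF T])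
  then show ?thesis using w T bounded_ops_comp by (auto simp: finite_rank_ops_def)
qed

lemma dual_space_comp:
  assumes f: "f \<in> dual_space X" and T: "T \<in> bounded_ops X X"
  shows "f \<circ> T \<in> dual_space X"
proof -
  obtain M where M: "\<And>x. x \<in> carr X \<Longrightarrow> nrm X (T x) \<le> M * nrm X x"
    using bounded_ops_bound[OF T] by blast
  obtain L where L: "\<And>x. x \<in> carr X \<Longrightarrow> cmod (f x) \<le> L * nrm X x"
    using f unfolding dual_space_def by blast
  have "cmod (f (T x)) \<le> (\<bar>L\<bar> * M) * nrm X x" if x: "x \<in> carr X" for x
  proof -
    have "cmod (f (T x)) \<le> L * nrm X (T x)" using L bounded_ops_in_carr[OF T] .
    also have "\<dots> \<le> \<bar>L\<bar> * nrm X (T x)" using nrm_nonneg' by (intro mult_right_mono) auto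
    also have "\<dots> \<le> \<bar>L\<bar> * (M * nrm X x)" using M[OF x] by (intro mult_left_mono) auto
    finally show ?thesis by (simp add: mult.assoc)
  qed
  then have bd: "\<exists>M. \<forall>x\<in>carr X. cmod ((f \<circ> T) x) \<le> M * nrm X x" by auto
  have "f (0 *\<^sub>C 0) = 0 * f 0"
    using f cvs.subspace_0[OF subspace_carr] unfolding dual_space_def by blast
  then have "f 0 = 0" by simp
  then show ?thesis
    using f bd unfolding dual_space_def by (simp add: bounded_opsD[OF T])
qed

lemma finite_rank_ops_right:
  assumes w: "w \<in> finite_rank_ops X" and T: "T \<in> bounded_ops X X"
  shows "w \<circ> T \<in> finite_rank_ops X"
proof -
  obtain N f y where rep: "finite_rep X w N f y" using w by (auto simp: finite_rank_ops_def)
  then have "finite_rep X (w \<circ> T) N (\<lambda>k. f k \<circ> T) y"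
    using T by (auto simp: finite_rep_def fun_eq_iff intro: dual_space_comp)
  then show ?thesis using w T bounded_ops_comp by (auto simp: finite_rank_ops_def)
qed

lemma finite_rep_diff:
  assumes u: "finite_rep X u N f y" and v: "finite_rep X v M h z"
  defines "F \<equiv> \<lambda>k. if k < N then f k else h (k - N)"
    and "Y \<equiv> \<lambda>k. if k < N then y k else - z (k - N)"
  shows "finite_rep X (\<lambda>x. u x - v x) (N + M) F Y"
    and "op_trace X (\<lambda>x. u x - v x) = op_trace X u - op_trace X v"
proof -
  have split: "(\<Sum>k<N + M. G k) = (\<Sum>k<N. G k) + (\<Sum>k<M. G (N + k))" for G :: "nat \<Rightarrow> 'b::comm_monoid_add"
    by (induction M) (simp_all add: add.assoc)
  show rep: "finite_rep X (\<lambda>x. u x - v x) (N + M) F Y"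
    using assms cvs.subspace_neg[OF subspace_carr]
    by (auto simp: finite_rep_def F_def Y_def split sum_negf)
  have h_neg: "h k (- z k) = - h k (z k)" if "k < M" for k
  proof -
    have "h k (-1 *\<^sub>C z k) = -1 * h k (z k)"
      using v that unfolding finite_rep_def dual_space_def by blast
    then show ?thesis by (simp add: scaleC_one)
  qed
  show "op_trace X (\<lambda>x. u x - v x) = op_trace X u - op_trace X v"
    unfolding op_trace_eq[OF complex_banach_axioms rep] op_trace_eq[OF complex_banach_axioms u]
      op_trace_eq[OF complex_banach_axioms v]
    by (simp add: split F_def Y_def h_neg sum_negf)
qed

lemma op_trace_diff:
  assumes "u \<in> finite_rank_ops X" "v \<in> finite_rank_ops X"
  shows "op_trace X (\<lambda>x. u x - v x) = op_trace X u - op_trace X v"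
  using assms finite_rep_diff(2) unfolding finite_rank_ops_def by blast

lemma finite_rank_ops_diff:
  assumes u: "u \<in> finite_rank_ops X" and v: "v \<in> finite_rank_ops X"
    and "(\<lambda>x. u x - v x) \<in> bounded_ops X X"
  shows "(\<lambda>x. u x - v x) \<in> finite_rank_ops X"
  using assms finite_rep_diff(1) unfolding finite_rank_ops_def by blast

end

section \<open>Spectral formulas for trace and determinant\<close>

interpretation cvs_pair: vector_space_pair "scaleC :: complex \<Rightarrow> 'a \<Rightarrow> 'a::complex_vector"
  "scaleC :: complex \<Rightarrow> 'b \<Rightarrow> 'b::complex_vector"
  by unfold_locales

lemma (in complex_linear) sum: "g (\<Sum>k\<in>S. c k *\<^sub>C y k) = (\<Sum>k\<in>S. c k *\<^sub>C g (y k))"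
  by (induction S rule: infinite_finite_induct) (simp_all add: zero add scale)

context complex_banach
begin

text \<open>The family \<open>l\<close> is the diagonal of \<open>u\<close> in a triangular basis of generalized eigenvectors of the
  span of its range, so each nonzero eigenvalue occurs as often as its multiplicity.\<close>

lemma finite_rank_spectral:
  assumes u: "u \<in> finite_rank_ops X"
  obtains B :: "'a set" and l where "finite B" "\<forall>n. op_trace X (u ^^ Suc n) = (\<Sum>b\<in>B. l b ^ Suc n)"
    "fredholm_det X u = (\<Prod>b\<in>B. 1 - l b)" "\<forall>b\<in>B. op_eigenvalue X u (l b)"
proof -
  have bu: "u \<in> bounded_ops X X" using u by (simp add: finite_rank_ops_def)
  obtain N f y where rep: "finite_rep X u N f y" using u by (auto simp: finite_rank_ops_def)
  define C where "C = y ` {..<N}"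
  let ?F = "cvs.span C"
  have fin: "finite C" by (simp add: C_def)
  have FX: "?F \<subseteq> carr X"
    using rep by (intro cvs.span_minimal subspace_carr) (auto simp: C_def finite_rep_def)
  have u_eq: "u x = (\<Sum>k<N. f k x *\<^sub>C y k)" for x using rep by (simp add: finite_rep_def)
  have uF: "u x \<in> ?F" for x
    unfolding u_eq by (intro cvs.span_sum cvs.span_scale cvs.span_base) (auto simp: C_def)
  \<comment> \<open>\<open>u\<close> is linear only on \<open>carr X\<close>. It is replaced by a linear map of the whole universe that
    agrees with \<open>u\<close> on the span of the range.\<close>
  obtain B0 where B0: "B0 \<subseteq> C" "cvs.independent B0" "C \<subseteq> cvs.span B0"
    using cvs.maximal_independent_subset by blast
  obtain g where lin: "Vector_Spaces.linear scaleC scaleC g" and gB0: "\<And>x. x \<in> B0 \<Longrightarrow> g x = u x"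
    using cvs_pair.linear_independent_extend[OF B0(2), of u] by blast
  interpret lin: Vector_Spaces.linear scaleC scaleC g by (rule lin)
  interpret complex_linear g by unfold_locales (rule lin.add lin.scale)+
  have gF: "g x = u x" if "x \<in> ?F" for x
  proof -
    have "x \<in> cvs.span B0"
      using that B0(3) cvs.span_minimal[OF _ cvs.subspace_span] by blast
    moreover have "B0 \<subseteq> carr X" using B0(1) FX cvs.span_superset by blast
    ultimately have "x \<in> carr X \<and> g x = u x"
    proof (induction rule: cvs.span_induct_alt)
      case base
      show ?case using cvs.subspace_0[OF subspace_carr] by (simp add: zero bounded_ops_zero[OF bu])
    next
      case (step c b z)
      then have "b \<in> carr X" "c *\<^sub>C b \<in> carr X" using cvs.subspace_scale[OF subspace_carr] by blast+
      with step show ?case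
        by (simp add: add scale gB0 bounded_opsD(3,4)[OF bu] cvs.subspace_add[OF subspace_carr])
    qed
    then show ?thesis by blast
  qed
  have "g ` ?F \<subseteq> ?F" using gF uF by force
  then obtain l B where B: "gen_eigenbasis g l B" and BF: "cvs.span B = ?F"
    using gen_eigenbasis_exists[OF fin] by blast
  note finB = gen_eigenbasis_finite[OF B] and indB = gen_eigenbasis_independent[OF B]
  have B_F: "b \<in> ?F" if "b \<in> B" for b using that BF cvs.span_base by blast
  have pow: "(u ^^ n) x = (g ^^ n) x \<and> (u ^^ n) x \<in> ?F" if "x \<in> ?F" for n x
    using that by (induction n) (auto simp: gF uF)
  have trace: "op_trace X (u ^^ Suc n) = (\<Sum>b\<in>B. l b ^ Suc n)" for n
  proof -
    interpret gn: complex_linear "g ^^ n" by (rule complex_linear_funpow)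
    have yF: "y k \<in> ?F" if "k < N" for k using that by (intro cvs.span_base) (simp add: C_def)
    have "(u ^^ Suc n) x = (\<Sum>k<N. f k x *\<^sub>C (u ^^ n) (y k))" for x
    proof -
      have "(u ^^ Suc n) x = (g ^^ n) (u x)" using pow[OF uF] by (simp add: funpow_swap1)
      also have "\<dots> = (\<Sum>k<N. f k x *\<^sub>C (g ^^ n) (y k))" unfolding u_eq by (rule gn.sum)
      finally show ?thesis using pow yF by simp
    qed
    then have rep_n: "finite_rep X (u ^^ Suc n) N f (\<lambda>k. (u ^^ n) (y k))"
      using rep pow yF FX unfolding finite_rep_def fun_eq_iff by blast
    have "op_trace X (u ^^ Suc n) = (\<Sum>b\<in>B. cvs.representation B ((u ^^ Suc n) b) b)"
      unfolding op_trace_eq[OF complex_banach_axioms rep_n]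
    proof (rule sum_finite_rep_eq[OF complex_banach_axioms rep_n finB indB])
      show "B \<subseteq> carr X" using B_F FX by blast
      show "(u ^^ n) (y k) \<in> cvs.span B" if "k < N" for k unfolding BF using pow[OF yF[OF that]] by blast
    qed
    also have "\<dots> = (\<Sum>b\<in>B. cvs.representation B ((g ^^ Suc n) b) b)"
      using pow[OF B_F, of _ "Suc n"] by (intro sum.cong refl) simp
    also have "\<dots> = (\<Sum>b\<in>B. l b ^ Suc n)" by (rule gen_eigenbasis_funpow_trace[OF B])
    finally show ?thesis .
  qed
  let ?h = "\<lambda>\<mu> z. u z - \<mu> *\<^sub>C z"
  have h_pow: "(?h \<mu> ^^ n) x = (shift \<mu> ^^ n) x \<and> (shift \<mu> ^^ n) x \<in> ?F" if "x \<in> ?F" for \<mu> n x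
    using that
  proof (induction n)
    case (Suc n)
    then show ?case
      using uF by (auto simp: shift_def gF intro!: cvs.span_diff cvs.span_scale)
  qed simp
  \<comment> \<open>For \<open>\<mu> \<noteq> 0\<close> the generalized eigenvectors lie in the span of the range.\<close>
  have in_F: "x \<in> ?F" if "(?h \<mu> ^^ n) x \<in> ?F" "\<mu> \<noteq> 0" for \<mu> n x
    using that(1)
  proof (induction n arbitrary: x)
    case (Suc n)
    have "(?h \<mu> ^^ n) (?h \<mu> x) \<in> ?F"
      using Suc.prems by (simp only: funpow_Suc_right comp_apply)
    then have "?h \<mu> x \<in> ?F" by (rule Suc.IH)
    then have "u x - ?h \<mu> x \<in> ?F" by (rule cvs.span_diff[OF uF])
    then have "\<mu> *\<^sub>C x \<in> ?F" by simp
    then have "(1 / \<mu>) *\<^sub>C (\<mu> *\<^sub>C x) \<in> ?F" by (rule cvs.span_scale)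
    then show ?case using that(2) by simp
  qed simp
  let ?B = "\<lambda>\<mu>. {b \<in> B. l b = \<mu>}"
  have gen: "{x \<in> carr X. \<exists>n. (?h \<mu> ^^ n) x = 0} = ?F \<inter> gen_eigenspace \<mu>" if "\<mu> \<noteq> 0" for \<mu>
  proof (intro set_eqI iffI)
    fix x assume "x \<in> {x \<in> carr X. \<exists>n. (?h \<mu> ^^ n) x = 0}"
    then obtain n where n: "(?h \<mu> ^^ n) x = 0" by blast
    then have "x \<in> ?F" using in_F[of n \<mu> x] that cvs.span_zero by metis
    with n show "x \<in> ?F \<inter> gen_eigenspace \<mu>" using h_pow by (auto simp: gen_eigenspace_def)
  next
    fix x assume "x \<in> ?F \<inter> gen_eigenspace \<mu>"
    then show "x \<in> {x \<in> carr X. \<exists>n. (?h \<mu> ^^ n) x = 0}"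
      using h_pow FX by (auto simp: gen_eigenspace_def)
  qed
  have gen_span: "?F \<inter> gen_eigenspace \<mu> \<subseteq> cvs.span (?B \<mu>)" for \<mu>
    using gen_eigenbasis_span_gen_eigenspace[OF B] by (auto simp: BF)
  have B_gen: "?B \<mu> \<subseteq> ?F \<inter> gen_eigenspace \<mu>" for \<mu>
    using gen_eigenbasis_gen_eigenspace[OF B] B_F by auto
  have mult: "eigenvalue_mult X u \<mu> = card (?B \<mu>)" if "\<mu> \<noteq> 0" for \<mu>
    unfolding eigenvalue_mult_def gen[OF that]
  proof (rule cvs.dim_unique[OF B_gen gen_span])
    show "cvs.independent (?B \<mu>)" using indB by (rule cvs.independent_mono) blast
  qed simp
  have ev1: "?B \<mu> \<noteq> {}" if ev: "op_eigenvalue X u \<mu>" and \<mu>: "\<mu> \<noteq> 0" for \<mu>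
  proof
    assume empty: "?B \<mu> = {}"
    obtain x where x: "x \<in> carr X" "x \<noteq> 0" "u x = \<mu> *\<^sub>C x"
      using ev unfolding op_eigenvalue_def by blast
    then have "(?h \<mu> ^^ 1) x = 0" by simp
    with x(1) have "x \<in> ?F \<inter> gen_eigenspace \<mu>" unfolding gen[OF \<mu>, symmetric] by blast
    then have "x \<in> cvs.span {}" using gen_span[of \<mu>] unfolding empty by blast
    then show False using x(2) by simp
  qed
  have ev2: "op_eigenvalue X u (l b)" if b: "b \<in> B" for b
  proof -
    have "b \<noteq> 0" using indB b cvs.dependent_zero by blast
    have "b \<in> gen_eigenspace (l b)" using B_gen b by blast
    then obtain n0 where n0: "(shift (l b) ^^ n0) b = 0" by (auto simp: gen_eigenspace_def)
    define n where "n = (LEAST n. (shift (l b) ^^ n) b = 0)"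
    have n: "(shift (l b) ^^ n) b = 0" unfolding n_def using n0 by (rule LeastI)
    then obtain m where m: "n = Suc m" using \<open>b \<noteq> 0\<close> by (cases n) auto
    let ?x = "(shift (l b) ^^ m) b"
    have "?x \<noteq> 0" using not_less_Least[of m "\<lambda>n. (shift (l b) ^^ n) b = 0"] m by (auto simp: n_def)
    moreover have xF: "?x \<in> ?F" using h_pow[OF B_F[OF b]] by blast
    moreover have "u ?x = l b *\<^sub>C ?x" using n m gF[OF xF] by (simp add: shift_def)
    ultimately show ?thesis using FX unfolding op_eigenvalue_def by blast
  qed
  have evs: "{\<mu>. op_eigenvalue X u \<mu> \<and> \<mu> \<noteq> 0} = l ` B - {0}" using ev1 ev2 by blast
  have "fredholm_det X u = (\<Prod>\<mu>\<in>l ` B - {0}. (1 - \<mu>) ^ card (?B \<mu>))"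
    unfolding fredholm_det_def evs by (intro prod.cong) (simp_all add: mult)
  also have "\<dots> = (\<Prod>\<mu>\<in>l ` B. (1 - \<mu>) ^ card (?B \<mu>))"
    using finB by (intro prod.mono_neutral_left) auto
  also have "\<dots> = (\<Prod>\<mu>\<in>l ` B. \<Prod>b\<in>?B \<mu>. 1 - l b)" by (intro prod.cong) simp_all
  also have "\<dots> = (\<Prod>b\<in>B. 1 - l b)" by (rule prod.image_gen[OF finB, symmetric])
  finally have det: "fredholm_det X u = (\<Prod>b\<in>B. 1 - l b)" .
  show thesis
  proof (rule that[of B l])
    show "\<forall>n. op_trace X (u ^^ Suc n) = (\<Sum>b\<in>B. l b ^ Suc n)" using trace by (rule allI)
    show "\<forall>b\<in>B. op_eigenvalue X u (l b)" using ev2 by (rule ballI)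
  qed (fact finB det)+
qed

text \<open>All eigenvalues have modulus at most \<open>\<rho>\<close>, so the logarithms of \<open>1 - l b\<close> are given by
  the power series of \<open>ln\<close>.\<close>

lemma fredholm_det_eq_exp:
  assumes u: "u \<in> finite_rank_ops X" and \<rho>: "\<rho> < 1"
    and le: "\<And>x. x \<in> carr X \<Longrightarrow> nrm X (u x) \<le> \<rho> * nrm X x"
  obtains s where "(\<lambda>n. op_trace X (u ^^ Suc n) / of_nat (Suc n)) sums s" "fredholm_det X u = exp (- s)"
proof -
  obtain B :: "'a set" and l where B: "finite B"
    and tr: "\<forall>n. op_trace X (u ^^ Suc n) = (\<Sum>b\<in>B. l b ^ Suc n)"
    and det: "fredholm_det X u = (\<Prod>b\<in>B. 1 - l b)"
    and ev: "\<forall>b\<in>B. op_eigenvalue X u (l b)"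
    by (rule finite_rank_spectral[OF u])
  have trace: "op_trace X (u ^^ Suc n) = (\<Sum>b\<in>B. l b ^ Suc n)" for n using tr by (rule spec)
  have l1: "cmod (l b) < 1" if b: "b \<in> B" for b
  proof -
    obtain x where x: "x \<in> carr X" "x \<noteq> 0" "u x = l b *\<^sub>C x"
      using ev b unfolding op_eigenvalue_def by blast
    then have "cmod (l b) * nrm X x \<le> \<rho> * nrm X x" using le[of x] by (simp add: nrm_scaleC)
    moreover have "0 < nrm X x" using x nrm_eq_0_iff nrm_nonneg by force
    ultimately show ?thesis using \<rho> by (simp add: mult_le_cancel_right)
  qed
  have series: "(\<lambda>n. - (l b ^ Suc n / of_nat (Suc n))) sums ln (1 - l b)" if "b \<in> B" for b
  proof -
    have "(\<lambda>n. - ((- (- l b)) ^ n) / of_nat n) sums ln (1 + - l b)"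
      by (rule Ln_series') (use l1[OF that] in simp)
    then show ?thesis
      by (subst sums_Suc_iff[of "\<lambda>n. - (l b ^ n / of_nat n)"]) simp
  qed
  have "(\<lambda>n. \<Sum>b\<in>B. - (l b ^ Suc n / of_nat (Suc n))) sums (\<Sum>b\<in>B. ln (1 - l b))"
    by (intro sums_sum series)
  then have "(\<lambda>n. - (\<Sum>b\<in>B. - (l b ^ Suc n / of_nat (Suc n)))) sums - (\<Sum>b\<in>B. ln (1 - l b))"
    by (rule sums_minus)
  then have "(\<lambda>n. op_trace X (u ^^ Suc n) / of_nat (Suc n)) sums - (\<Sum>b\<in>B. ln (1 - l b))"
    unfolding trace sum_divide_distrib sum_negf minus_minus .
  moreover have "fredholm_det X u = exp (\<Sum>b\<in>B. ln (1 - l b))"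
    unfolding det exp_sum[OF B]
  proof (intro prod.cong refl)
    fix b assume "b \<in> B"
    then have "1 - l b \<noteq> 0" using l1 by fastforce
    then show "1 - l b = exp (ln (1 - l b))" by simp
  qed
  ultimately show thesis using that by simp
qed

end

section \<open>Lipschitz continuity of the determinant\<close>

lemma norm_exp_diff_le:
  fixes x y :: complex
  assumes "cmod x \<le> R" "cmod y \<le> R"
  shows "cmod (exp x - exp y) \<le> exp R * cmod (x - y)"
proof (rule field_differentiable_bound[of "cball 0 R" exp exp])
  show "cmod (exp z) \<le> exp R" if "z \<in> cball 0 R" for z
    using that complex_Re_le_cmod[of z] by simp
qed (use assms in \<open>auto intro: DERIV_subset DERIV_exp\<close>)

context quasinormed_operator_ideal
begin

text \<open>Since \<open>q\<close> dominates the operator norm, it is submultiplicative on \<open>A X X\<close>.\<close>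

lemma
  assumes X: "complex_banach X" and w: "w \<in> finite_rank_ops X \<inter> A X X" and u: "u \<in> A X X"
  shows finite_rank_comp_left: "u \<circ> w \<in> finite_rank_ops X \<inter> A X X"
    and quasinorm_comp_left: "q X X (u \<circ> w) \<le> q X X u * q X X w"
    and finite_rank_comp_right: "w \<circ> u \<in> finite_rank_ops X \<inter> A X X"
    and quasinorm_comp_right: "q X X (w \<circ> u) \<le> q X X u * q X X w"
proof -
  interpret X: complex_banach X by (rule X)
  have ub: "u \<in> bounded_ops X X" and wb: "w \<in> bounded_ops X X"
    using ideal_subset[OF X X] u w by blast+
  have id: "id_op X \<in> bounded_ops X X"
    using cvs.subspace_add[OF X.subspace_carr] cvs.subspace_scale[OF X.subspace_carr]
    by (auto simp: bounded_ops_def id_op_def intro: exI[of _ 1])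
  have w1: "w \<circ> id_op X = w" and w2: "id_op X \<circ> w = w" and u1: "u \<circ> w \<circ> id_op X = u \<circ> w"
    using bounded_opsD(2)[OF wb] X.bounded_ops_zero[OF wb] X.bounded_ops_in_carr[OF wb]
    by (auto simp: id_op_def fun_eq_iff)
  have op_u: "op_nrm X X u \<le> q X X u"
    using q_nonneg[OF X X u] nrm_le_quasinorm[OF X X u] by (intro op_nrm_le[OF X]) auto
  have op_id: "op_nrm X X (id_op X) \<le> 1" by (rule op_nrm_le[OF X]) (auto simp: id_op_def)
  note nonneg = op_nrm_nonneg[OF X X ub] op_nrm_nonneg[OF X X id] q_nonneg[OF X X, of w] q_nonneg[OF X X u]
  have wA: "w \<in> A X X" using w by simp
  show "u \<circ> w \<in> finite_rank_ops X \<inter> A X X"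
    using ideal_comp[OF X X X X id wA ub] X.finite_rank_ops_left[OF _ ub] w by (simp add: u1)
  show "w \<circ> u \<in> finite_rank_ops X \<inter> A X X"
    using ideal_comp[OF X X X X ub wA id] X.finite_rank_ops_right[OF _ ub] w by (simp add: w2)
  have "q X X (u \<circ> w) \<le> op_nrm X X u * q X X w * op_nrm X X (id_op X)"
    using q_comp[OF X X X X id wA ub] by (simp add: u1)
  also have "\<dots> \<le> q X X u * q X X w * 1"
    using nonneg wA op_u op_id by (intro mult_mono mult_nonneg_nonneg) auto
  finally show "q X X (u \<circ> w) \<le> q X X u * q X X w" by simp
  have "q X X (w \<circ> u) \<le> op_nrm X X (id_op X) * q X X w * op_nrm X X u"
    using q_comp[OF X X X X ub wA id] by (simp add: w2)
  also have "\<dots> \<le> 1 * q X X w * q X X u"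
    using nonneg wA op_u op_id by (intro mult_mono mult_nonneg_nonneg) auto
  finally show "q X X (w \<circ> u) \<le> q X X u * q X X w" by (simp add: mult.commute)
qed

lemma
  assumes X: "complex_banach X" and w: "w \<in> finite_rank_ops X \<inter> A X X"
    and u: "u \<in> A X X" "q X X u \<le> \<rho>" and v: "v \<in> A X X" "q X X v \<le> \<rho>"
  shows finite_rank_funpow_comp: "(u ^^ k) \<circ> w \<circ> (v ^^ m) \<in> finite_rank_ops X \<inter> A X X"
    and quasinorm_funpow_comp: "q X X ((u ^^ k) \<circ> w \<circ> (v ^^ m)) \<le> \<rho> ^ (k + m) * q X X w"
proof -
  have \<rho>: "0 \<le> \<rho>" using q_nonneg[OF X X u(1)] u(2) by simp
  have right: "w \<circ> (v ^^ m) \<in> finite_rank_ops X \<inter> A X X \<and>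
      q X X (w \<circ> (v ^^ m)) \<le> \<rho> ^ m * q X X w" for m
  proof (induction m)
    case (Suc m)
    let ?w = "w \<circ> (v ^^ m)"
    have eq: "w \<circ> (v ^^ Suc m) = ?w \<circ> v" by (simp add: funpow_swap1 fun_eq_iff)
    have "q X X (?w \<circ> v) \<le> q X X v * q X X ?w" using quasinorm_comp_right[OF X _ v(1)] Suc by blast
    also have "\<dots> \<le> \<rho> * (\<rho> ^ m * q X X w)"
      using Suc v(2) \<rho> q_nonneg[OF X X, of ?w] by (intro mult_mono) (simp_all del: comp_apply)
    finally show ?case
      using finite_rank_comp_right[OF X _ v(1), of ?w] Suc by (simp only: eq power_Suc mult.assoc simp_thms)
  qed (use w in simp)
  have "(u ^^ k) \<circ> (w \<circ> (v ^^ m)) \<in> finite_rank_ops X \<inter> A X X \<and>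
      q X X ((u ^^ k) \<circ> (w \<circ> (v ^^ m))) \<le> \<rho> ^ (k + m) * q X X w"
  proof (induction k)
    case 0
    show ?case using right[of m] by (simp only: funpow.simps(1) id_comp add_0)
  next
    case (Suc k)
    let ?w = "(u ^^ k) \<circ> (w \<circ> (v ^^ m))"
    have eq: "(u ^^ Suc k) \<circ> (w \<circ> (v ^^ m)) = u \<circ> ?w" by (simp add: fun_eq_iff)
    have "q X X (u \<circ> ?w) \<le> q X X u * q X X ?w" using quasinorm_comp_left[OF X _ u(1)] Suc by blast
    also have "\<dots> \<le> \<rho> * (\<rho> ^ (k + m) * q X X w)"
      using Suc u(2) \<rho> q_nonneg[OF X X, of ?w] by (intro mult_mono) (simp_all del: comp_apply)
    finally show ?case
      using finite_rank_comp_left[OF X _ u(1), of ?w] Suc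
      by (simp only: eq power_Suc mult.assoc simp_thms add_Suc)
  qed
  then show "(u ^^ k) \<circ> w \<circ> (v ^^ m) \<in> finite_rank_ops X \<inter> A X X"
    "q X X ((u ^^ k) \<circ> w \<circ> (v ^^ m)) \<le> \<rho> ^ (k + m) * q X X w"
    by (simp_all add: comp_assoc)
qed

lemma finite_rank_ideal_diff:
  assumes X: "complex_banach X" and u: "u \<in> finite_rank_ops X \<inter> A X X" and v: "v \<in> finite_rank_ops X \<inter> A X X"
  shows "(\<lambda>x. u x - v x) \<in> finite_rank_ops X \<inter> A X X"
proof -
  have "(\<lambda>x. u x + -1 *\<^sub>C v x) \<in> A X X"
    using u v by (intro ideal_add[OF X X] ideal_scaleC[OF X X]) auto
  then have "(\<lambda>x. u x - v x) \<in> A X X" by (simp add: scaleC_one)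
  then show ?thesis
    using complex_banach.finite_rank_ops_diff[OF X] ideal_subset[OF X X] u v by blast
qed

text \<open>The difference of the powers is the telescoping sum of \<open>u\<^sup>k (u - v) v\<^sup>n\<^sup>-\<^sup>k\<close>.\<close>

lemma trace_funpow_diff_le:
  assumes X: "complex_banach X" and b: "0 \<le> b"
    and trace: "\<And>w. w \<in> finite_rank_ops X \<inter> A X X \<Longrightarrow> cmod (op_trace X w) \<le> b * q X X w"
    and u: "u \<in> finite_rank_ops X \<inter> A X X" "q X X u \<le> \<rho>"
    and v: "v \<in> finite_rank_ops X \<inter> A X X" "q X X v \<le> \<rho>"
  shows "cmod (op_trace X (u ^^ Suc n) - op_trace X (v ^^ Suc n))
    \<le> real (Suc n) * (b * \<rho> ^ n * q X X (\<lambda>x. u x - v x))"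
proof -
  interpret X: complex_banach X by (rule X)
  let ?w = "\<lambda>x. u x - v x"
  have w: "?w \<in> finite_rank_ops X \<inter> A X X" by (rule finite_rank_ideal_diff[OF X u(1) v(1)])
  have uA: "u \<in> A X X" and vA: "v \<in> A X X" using u v by auto
  have ub: "u \<in> bounded_ops X X" and vb: "v \<in> bounded_ops X X" using u v by (auto simp: finite_rank_ops_def)
  let ?T = "\<lambda>k. op_trace X ((u ^^ k) \<circ> (v ^^ (Suc n - k)))"
  have step: "cmod (?T (Suc k) - ?T k) \<le> b * \<rho> ^ n * q X X ?w" if k: "k < Suc n" for k
  proof -
    let ?c = "\<lambda>z. (u ^^ k) \<circ> z \<circ> (v ^^ (n - k))"
    have eqs: "(u ^^ Suc k) \<circ> (v ^^ (Suc n - Suc k)) = ?c u" "(u ^^ k) \<circ> (v ^^ (Suc n - k)) = ?c v"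
      using k by (auto simp: fun_eq_iff funpow_swap1 Suc_diff_le)
    have "?c ?w = (\<lambda>x. ?c u x - ?c v x)"
      using X.bounded_ops_in_carr[OF ub] X.bounded_ops_in_carr[OF vb]
      by (simp add: fun_eq_iff X.bounded_ops_funpow_diff[OF ub])
    then have "op_trace X (?c ?w) = op_trace X (?c u) - op_trace X (?c v)"
      using X.op_trace_diff[of "?c u" "?c v"] finite_rank_funpow_comp[OF X u(1) uA u(2) vA v(2), of k "n - k"]
        finite_rank_funpow_comp[OF X v(1) uA u(2) vA v(2), of k "n - k"]
      by simp
    then have "?T (Suc k) - ?T k = op_trace X (?c ?w)" unfolding eqs by simp
    also have "cmod \<dots> \<le> b * q X X (?c ?w)" by (intro trace finite_rank_funpow_comp[OF X w uA u(2) vA v(2)])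
    also have "\<dots> \<le> b * (\<rho> ^ (k + (n - k)) * q X X ?w)"
      by (intro mult_left_mono b quasinorm_funpow_comp[OF X w uA u(2) vA v(2)])
    finally show ?thesis using k by (simp add: mult.assoc)
  qed
  have "op_trace X (u ^^ Suc n) - op_trace X (v ^^ Suc n) = (\<Sum>k<Suc n. ?T (Suc k) - ?T k)"
    unfolding sum_lessThan_telescope[of ?T] by (simp only: diff_self_eq_0 diff_zero funpow.simps(1) comp_id id_comp)
  also have "cmod \<dots> \<le> (\<Sum>k<Suc n. b * \<rho> ^ n * q X X ?w)"
    by (rule sum_norm_le) (use step in auto)
  finally show ?thesis by simp
qed

lemma fredholm_det_lipschitz:
  assumes X: "complex_banach X" and b: "0 \<le> b"
    and trace: "\<And>w. w \<in> finite_rank_ops X \<inter> A X X \<Longrightarrow> cmod (op_trace X w) \<le> b * q X X w"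
    and u: "u \<in> finite_rank_ops X \<inter> A X X" "q X X u \<le> 1/2"
    and v: "v \<in> finite_rank_ops X \<inter> A X X" "q X X v \<le> 1/2"
  shows "cmod (fredholm_det X u - fredholm_det X v) \<le> exp b * (2 * b) * q X X (\<lambda>x. u x - v x)"
proof -
  have uA: "u \<in> A X X" and vA: "v \<in> A X X" using u v by auto
  have series: "\<exists>s. (\<lambda>n. op_trace X (w ^^ Suc n) / of_nat (Suc n)) sums s \<and>
      fredholm_det X w = exp (- s)"
    if w: "w \<in> finite_rank_ops X \<inter> A X X" "q X X w \<le> 1/2" for w
  proof -
    have "nrm X (w x) \<le> 1/2 * nrm X x" if x: "x \<in> carr X" for x
    proof -
      have "nrm X (w x) \<le> q X X w * nrm X x" using w by (intro nrm_le_quasinorm[OF X X _ x]) auto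
      also have "\<dots> \<le> 1/2 * nrm X x"
        using w(2) complex_banach.nrm_nonneg'[OF X] by (rule mult_right_mono)
      finally show ?thesis .
    qed
    then show ?thesis
      using complex_banach.fredholm_det_eq_exp[OF X, of w "1/2"] w(1) by auto
  qed
  obtain s where s: "(\<lambda>n. op_trace X (u ^^ Suc n) / of_nat (Suc n)) sums s"
    "fredholm_det X u = exp (- s)" using series[OF u] by blast
  obtain t where t: "(\<lambda>n. op_trace X (v ^^ Suc n) / of_nat (Suc n)) sums t"
    "fredholm_det X v = exp (- t)" using series[OF v] by blast
  have diff_le: "cmod (s - t) \<le> 2 * b * q X X (\<lambda>x. u x - v x)"
    if s: "(\<lambda>n. op_trace X (u ^^ Suc n) / of_nat (Suc n)) sums s"
      and t: "(\<lambda>n. op_trace X (v ^^ Suc n) / of_nat (Suc n)) sums t"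
      and u: "u \<in> finite_rank_ops X \<inter> A X X" "q X X u \<le> 1/2"
      and v: "v \<in> finite_rank_ops X \<inter> A X X" "q X X v \<le> 1/2" for u v s t
  proof -
    let ?D = "q X X (\<lambda>x. u x - v x)"
    have "(\<lambda>n. op_trace X (u ^^ Suc n) / of_nat (Suc n) - op_trace X (v ^^ Suc n) / of_nat (Suc n))
        sums (s - t)"
      using s t by (rule sums_diff)
    moreover have "(\<lambda>n. b * ?D * (1/2) ^ n) sums (b * ?D * 2)"
      using geometric_sums[of "1/2::real"] by (intro sums_mult) simp
    moreover have "cmod (op_trace X (u ^^ Suc n) / of_nat (Suc n) - op_trace X (v ^^ Suc n) / of_nat (Suc n))
        \<le> b * ?D * (1/2) ^ n" for n
    proof -
      have "cmod (op_trace X (u ^^ Suc n) / of_nat (Suc n) - op_trace X (v ^^ Suc n) / of_nat (Suc n))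
          = cmod (op_trace X (u ^^ Suc n) - op_trace X (v ^^ Suc n)) / real (Suc n)"
        unfolding diff_divide_distrib[symmetric] norm_divide norm_of_nat ..
      also have "\<dots> \<le> (real (Suc n) * (b * (1/2) ^ n * ?D)) / real (Suc n)"
        by (intro divide_right_mono trace_funpow_diff_le[OF X b trace u v]) auto
      finally show ?thesis by (simp add: mult_ac del: funpow.simps)
    qed
    ultimately have "cmod (s - t) \<le> b * ?D * 2" by (rule norm_sums_le)
    then show ?thesis by (simp add: mult_ac)
  qed
  have bound: "cmod s \<le> b"
    if s: "(\<lambda>n. op_trace X (u ^^ Suc n) / of_nat (Suc n)) sums s"
      and u: "u \<in> finite_rank_ops X \<inter> A X X" "q X X u \<le> 1/2" for u s
  proof -
    \<comment> \<open>This is the previous estimate against the zero operator.\<close>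
    have rep0: "finite_rep X (\<lambda>x. 0) 0 (\<lambda>k x. 0) (\<lambda>k. 0)" by (simp add: finite_rep_def)
    have z: "(\<lambda>x. 0) \<in> finite_rank_ops X \<inter> A X X"
      using ideal_zero[OF X X] ideal_subset[OF X X] rep0 unfolding finite_rank_ops_def by blast
    have z_pow: "((\<lambda>x. 0) ^^ Suc n) = (\<lambda>x::'a. 0::'a)" for n by (simp add: fun_eq_iff)
    have "op_trace X (\<lambda>x. 0) = 0" using op_trace_eq[OF X rep0] by simp
    then have "(\<lambda>n. op_trace X ((\<lambda>x. 0) ^^ Suc n) / of_nat (Suc n)) sums 0"
      unfolding z_pow by simp
    moreover have "q X X (\<lambda>x. 0) = 0" using q_eq_0_iff[OF X X] z by blast
    ultimately have "cmod (s - 0) \<le> 2 * b * q X X (\<lambda>x. u x - 0)"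
      using s u z by (intro diff_le) auto
    then show ?thesis using u(2) mult_left_mono[of "q X X u" "1/2" "2 * b"] b by simp
  qed
  have "cmod (exp (- s) - exp (- t)) \<le> exp b * cmod (- s - - t)"
    using bound[OF s(1) u] bound[OF t(1) v] by (intro norm_exp_diff_le) auto
  also have "cmod (- s - - t) = cmod (s - t)" by (simp add: norm_minus_commute)
  also have "exp b * cmod (s - t) \<le> exp b * (2 * b * q X X (\<lambda>x. u x - v x))"
    using diff_le[OF s(1) t(1) u v] by (intro mult_left_mono) auto
  finally show ?thesis by (simp add: s(2) t(2) mult.assoc)
qed

end

theorem mainTheorem3:
  fixes A :: "'a::complex_vector nspace \<Rightarrow> 'a nspace \<Rightarrow> ('a \<Rightarrow> 'a) set"
    and q :: "'a nspace \<Rightarrow> 'a nspace \<Rightarrow> ('a \<Rightarrow> 'a) \<Rightarrow> real"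
    and X :: "'a nspace"
  assumes ideal: "quasinormed_operator_ideal A q"
    and banach: "complex_banach X"
    and dense: "\<forall>u\<in>A X X. \<forall>\<epsilon>>0. \<exists>v\<in>finite_rank_ops X \<inter> A X X. q X X (\<lambda>x. u x - v x) < \<epsilon>"
    and trace_bounded:
      "\<exists>b. \<forall>u\<in>finite_rank_ops X \<inter> A X X. cmod (op_trace X u) \<le> b * q X X u"
  shows "(\<exists>r>0. \<forall>\<epsilon>>0. \<exists>\<delta>>0.
            \<forall>u\<in>finite_rank_ops X \<inter> A X X. \<forall>v\<in>finite_rank_ops X \<inter> A X X.
              q X X u \<le> r \<longrightarrow> q X X v \<le> r \<longrightarrow> q X X (\<lambda>x. u x - v x) < \<delta> \<longrightarrow>
              cmod (fredholm_det X u - fredholm_det X v) < \<epsilon>) \<and>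
         (\<exists>r0 c0. 0 < r0 \<and> r0 < 1 \<and> 0 < c0 \<and>
            (\<forall>u\<in>finite_rank_ops X \<inter> A X X. \<forall>v\<in>finite_rank_ops X \<inter> A X X.
              q X X u \<le> r0 \<longrightarrow> q X X v \<le> r0 \<longrightarrow>
              cmod (fredholm_det X u - fredholm_det X v) \<le> c0 * q X X (\<lambda>x. u x - v x)))"
proof -
  interpret quasinormed_operator_ideal A q by (rule ideal)
  let ?FA = "finite_rank_ops X \<inter> A X X"
  obtain b0 where b0: "\<And>u. u \<in> ?FA \<Longrightarrow> cmod (op_trace X u) \<le> b0 * q X X u"
    using trace_bounded by blast
  define b where "b = \<bar>b0\<bar>"
  have trace: "cmod (op_trace X u) \<le> b * q X X u" if u: "u \<in> ?FA" for u
  proof -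
    have "b0 * q X X u \<le> b * q X X u"
      using q_nonneg[OF banach banach, of u] u by (intro mult_right_mono) (auto simp: b_def)
    with b0[OF u] show ?thesis by simp
  qed
  define c where "c = exp b * (2 * b) + 1"
  have c: "c > 0" by (simp add: c_def b_def add_nonneg_pos)
  have lip: "cmod (fredholm_det X u - fredholm_det X v) \<le> c * q X X (\<lambda>x. u x - v x)"
    if u: "u \<in> ?FA" "q X X u \<le> 1/2" and v: "v \<in> ?FA" "q X X v \<le> 1/2" for u v
  proof -
    have "0 \<le> q X X (\<lambda>x. u x - v x)"
      using finite_rank_ideal_diff[OF banach u(1) v(1)] q_nonneg[OF banach banach] by blast
    then show ?thesis
      using fredholm_det_lipschitz[OF banach _ trace u v] by (simp add: c_def b_def algebra_simps)
  qed
  show ?thesis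
  proof (intro conjI)
    show "\<exists>r>0. \<forall>\<epsilon>>0. \<exists>\<delta>>0. \<forall>u\<in>?FA. \<forall>v\<in>?FA. q X X u \<le> r \<longrightarrow> q X X v \<le> r \<longrightarrow>
        q X X (\<lambda>x. u x - v x) < \<delta> \<longrightarrow> cmod (fredholm_det X u - fredholm_det X v) < \<epsilon>"
    proof (rule exI[of _ "1/2"], intro conjI allI impI)
      fix \<epsilon> :: real assume \<epsilon>: "\<epsilon> > 0"
      have "cmod (fredholm_det X u - fredholm_det X v) < \<epsilon>"
        if "u \<in> ?FA" "v \<in> ?FA" "q X X u \<le> 1/2" "q X X v \<le> 1/2" "q X X (\<lambda>x. u x - v x) < \<epsilon> / c" for u v
        using lip[of u v] that c by (simp add: field_simps)
      then show "\<exists>\<delta>>0. \<forall>u\<in>?FA. \<forall>v\<in>?FA. q X X u \<le> 1/2 \<longrightarrow> q X X v \<le> 1/2 \<longrightarrow>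
          q X X (\<lambda>x. u x - v x) < \<delta> \<longrightarrow> cmod (fredholm_det X u - fredholm_det X v) < \<epsilon>"
        using \<epsilon> c by (intro exI[of _ "\<epsilon> / c"]) simp
    qed simp
    show "\<exists>r0 c0. 0 < r0 \<and> r0 < 1 \<and> 0 < c0 \<and> (\<forall>u\<in>?FA. \<forall>v\<in>?FA. q X X u \<le> r0 \<longrightarrow> q X X v \<le> r0 \<longrightarrow>
        cmod (fredholm_det X u - fredholm_det X v) \<le> c0 * q X X (\<lambda>x. u x - v x))"
      using lip c by (intro exI[of _ "1/2"] exI[of _ c]) auto
  qed
qed

end
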